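(* Let $G$ and $G'$ be two connected graphs and let $\Phi : \mathcal{N}(G) \to \mathcal{N}(G')$ be a non-trivial nested complex isomorphism. Then $G$ and $G'$ are spiders, and there exists a graph isomorphism $\psi : G \to G'$ inducing a nested complex isomorphism $\Psi : \mathcal{N}(G) \to \mathcal{N}(G')$ (defined by $\Psi(t) \eqdef \{\psi(v) : v \in t\}$) such that the composition $\Psi^{-1} \circ \Phi$ coincides with the non-trivial nested complex automorphism $\Omega$ of $\mathcal{N}(G)$ described below.
   Context: For a graph $G$ with vertex set $V$, a tube is a non-empty subset of $V$ inducing a connected subgraph; the inclusion-maximal tubes are the connected components, all other tubes are proper. Two tubes are compatible if they are nested, or disjoint and non-adjacent (their union is not a tube). The nested complex $\mathcal{N}(G)$ is the simplicial complex whose faces are the sets of pairwise compatible proper tubes of $G$. A nested complex isomorphism $\mathcal{N}(G) \to \mathcal{N}(G')$ is a bijection from the tubes of $G$ to the tubes of $G'$ preserving compatibility; it is called trivial if it is induced by a graph isomorphism $\phi : G \to G'$ via $t \mapsto \{\phi(v) : v \in t\}$. For $\underline{n} = \{n_1, \dots, n_\ell\} \in \mathbb{N}^\ell$, the spider $S_{\underline{n}}$ is the graph with vertices $v^i_j$ ($i \in [\ell]$, $0 \le j \le n_i$) and edges $\{v^i_{j-1}, v^i_j\}$ ($i \in [\ell]$, $j \in [n_i]$) and $\{v^i_0, v^{i'}_0\}$ ($i \ne i' \in [\ell]$): paths (legs) each attached by an endpoint $v^i_0$ to a clique (body). Write $[v^i_j, v^i_k]$ for the path from $v^i_j$ to $v^i_k$,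 with the convention $[v^i_0, v^i_{-1}] = \varnothing$. The map $\Omega$ on tubes of $S_{\underline{n}}$ is defined by: for leg tubes (tubes disjoint from the body), $\Omega([v^i_j, v^i_k]) \eqdef [v^i_{n_i+1-k}, v^i_{n_i+1-j}]$ for $i \in [\ell]$, $1 \le j \le k \le n_i$; for body tubes (tubes meeting the body), $\Omega\big(\bigcup_{i \in [\ell]} [v^i_0, v^i_{k_i}]\big) \eqdef \bigcup_{i \in [\ell]} [v^i_0, v^i_{n_i-1-k_i}]$ for $-1 \le k_i \le n_i$. This $\Omega$ is a non-trivial involutive automorphism of $\mathcal{N}(S_{\underline{n}})$. *)

theory Defs
  imports "Graph_Theory.Graph_Theory"
begin

text \<open>
  A finite simple graph is a loop-free symmetric finite digraph without parallel arcs,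
  i.e. the locale predicate \<^const>\<open>pair_graph\<close>. The library predicate
  \<^const>\<open>connected\<close> requires at least one vertex.
\<close>

section \<open>Graph isomorphisms\<close>

definition graph_isomorphism ::
    "('a \<Rightarrow> 'b) \<Rightarrow> 'a pair_pre_digraph \<Rightarrow> 'b pair_pre_digraph \<Rightarrow> bool" where
  "graph_isomorphism \<phi> G H \<longleftrightarrow>
     bij_betw \<phi> (pverts G) (pverts H) \<and>
     (\<forall>u\<in>pverts G. \<forall>v\<in>pverts G. (u, v) \<in> parcs G \<longleftrightarrow> (\<phi> u, \<phi> v) \<in> parcs H)"


section \<open>Tubes and nested complexes\<close>

definition tubes :: "'a pair_pre_digraph \<Rightarrow> 'a set set" where
  "tubes G = {t. t \<subseteq> pverts G \<and> t \<noteq> {} \<and> connected (with_proj G \<restriction> t)}"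

definition proper_tubes :: "'a pair_pre_digraph \<Rightarrow> 'a set set" where
  "proper_tubes G = {t \<in> tubes G. \<exists>s\<in>tubes G. t \<subset> s}"

definition tube_compatible :: "'a pair_pre_digraph \<Rightarrow> 'a set \<Rightarrow> 'a set \<Rightarrow> bool" where
  "tube_compatible G s t \<longleftrightarrow>
     s \<subseteq> t \<or> t \<subseteq> s \<or> (s \<inter> t = {} \<and> s \<union> t \<notin> tubes G)"

definition nested_complex :: "'a pair_pre_digraph \<Rightarrow> 'a set set set" where
  "nested_complex G =
     {N. N \<subseteq> proper_tubes G \<and> (\<forall>s\<in>N. \<forall>t\<in>N. tube_compatible G s t)}"

text \<open>
  The vertices of the nested complex are the proper tubes, so a nested complex isomorphism is
  a bijection between the sets of proper tubes; its values on other sets are irrelevant.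
  Compatibility is preserved in both directions, see \<open>nested_complex_isomorphism_iff_faces\<close>.
\<close>

definition nested_complex_isomorphism ::
    "'a pair_pre_digraph \<Rightarrow> 'b pair_pre_digraph \<Rightarrow> ('a set \<Rightarrow> 'b set) \<Rightarrow> bool" where
  "nested_complex_isomorphism G H \<Phi> \<longleftrightarrow>
     bij_betw \<Phi> (proper_tubes G) (proper_tubes H) \<and>
     (\<forall>s\<in>proper_tubes G. \<forall>t\<in>proper_tubes G.
        tube_compatible G s t \<longleftrightarrow> tube_compatible H (\<Phi> s) (\<Phi> t))"

definition trivial_isomorphism ::
    "'a pair_pre_digraph \<Rightarrow> 'b pair_pre_digraph \<Rightarrow> ('a set \<Rightarrow> 'b set) \<Rightarrow> bool" where
  "trivial_isomorphism G H \<Phi> \<longleftrightarrow>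
     (\<exists>\<phi>. graph_isomorphism \<phi> G H \<and> (\<forall>t\<in>proper_tubes G. \<Phi> t = \<phi> ` t))"

lemma tube_compatible_refl: "tube_compatible G t t"
  by (simp add: tube_compatible_def)

lemma tube_compatible_sym: "tube_compatible G s t \<longleftrightarrow> tube_compatible G t s"
  by (auto simp: tube_compatible_def Un_commute Int_commute)

lemma pair_in_nested_complex_iff:
  "{s, t} \<in> nested_complex G \<longleftrightarrow>
     s \<in> proper_tubes G \<and> t \<in> proper_tubes G \<and> tube_compatible G s t"
  using tube_compatible_refl[of G s] tube_compatible_refl[of G t] tube_compatible_sym[of G s t]
  by (simp add: nested_complex_def)

lemma nested_complex_isomorphism_iff_faces:
  "nested_complex_isomorphism G H \<Phi> \<longleftrightarrow>
     bij_betw \<Phi> (proper_tubes G) (proper_tubes H) \<and>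
     (\<forall>N. N \<subseteq> proper_tubes G \<longrightarrow> (N \<in> nested_complex G \<longleftrightarrow> \<Phi> ` N \<in> nested_complex H))"
  (is "?L \<longleftrightarrow> ?R")
proof
  assume L: ?L
  then have b: "bij_betw \<Phi> (proper_tubes G) (proper_tubes H)"
    by (simp add: nested_complex_isomorphism_def)
  have "N \<in> nested_complex G \<longleftrightarrow> \<Phi> ` N \<in> nested_complex H" if N: "N \<subseteq> proper_tubes G" for N
  proof -
    have "\<Phi> ` N \<subseteq> proper_tubes H" using N b by (auto simp: bij_betw_def)
    moreover have "\<forall>s\<in>N. \<forall>t\<in>N. tube_compatible G s t \<longleftrightarrow> tube_compatible H (\<Phi> s) (\<Phi> t)"
      using L N by (auto simp: nested_complex_isomorphism_def)
    ultimately show ?thesis using N by (simp add: nested_complex_def)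
  qed
  with b show ?R by simp
next
  assume R: ?R
  have "tube_compatible G s t \<longleftrightarrow> tube_compatible H (\<Phi> s) (\<Phi> t)"
    if st: "s \<in> proper_tubes G" "t \<in> proper_tubes G" for s t
  proof -
    have "{s, t} \<in> nested_complex G \<longleftrightarrow> \<Phi> ` {s, t} \<in> nested_complex H"
      using R[THEN conjunct2, THEN spec, of "{s, t}"] st by simp
    moreover have "\<Phi> s \<in> proper_tubes H" "\<Phi> t \<in> proper_tubes H"
      using R st by (auto simp: bij_betw_def)
    ultimately show ?thesis using st by (simp add: pair_in_nested_complex_iff)
  qed
  with R show ?L by (simp add: nested_complex_isomorphism_def)
qed


section \<open>Spiders\<close>

text \<open>
  The vertex $v^i_j$ is the pair \<open>(i, j)\<close>; only the values of \<open>n\<close> on \<open>{1..l}\<close> matter.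
\<close>

definition spider :: "nat \<Rightarrow> (nat \<Rightarrow> nat) \<Rightarrow> (nat \<times> nat) pair_pre_digraph" where
  "spider l n =
     \<lparr> pverts = {(i, j). i \<in> {1..l} \<and> j \<le> n i},
       parcs = {((i, j - 1), (i, j)) | i j. i \<in> {1..l} \<and> j \<in> {1..n i}}
             \<union> {((i, j), (i, j - 1)) | i j. i \<in> {1..l} \<and> j \<in> {1..n i}}
             \<union> {((i, 0), (i', 0)) | i i'. i \<in> {1..l} \<and> i' \<in> {1..l} \<and> i \<noteq> i'} \<rparr>"

definition is_spider :: "'a pair_pre_digraph \<Rightarrow> bool" where
  "is_spider G \<longleftrightarrow> (\<exists>l n \<theta>. graph_isomorphism \<theta> (spider l n) G)"

text \<open>
  The path $[v^i_j, v^i_k]$, with integer bounds so that $[v^i_0, v^i_{-1}]$ is empty.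
\<close>

definition leg_path :: "nat \<Rightarrow> int \<Rightarrow> int \<Rightarrow> (nat \<times> nat) set" where
  "leg_path i j k = {(i, m) | m. j \<le> int m \<and> int m \<le> k}"

text \<open>
  The graph of $\Omega$. The rule \<open>body\<close> also covers the empty set and the full vertex set,
  which are not proper tubes and are exchanged.
\<close>

inductive spider_omega_rel ::
    "nat \<Rightarrow> (nat \<Rightarrow> nat) \<Rightarrow> (nat \<times> nat) set \<Rightarrow> (nat \<times> nat) set \<Rightarrow> bool"
  for l :: nat and n :: "nat \<Rightarrow> nat" where
  leg: "i \<in> {1..l} \<Longrightarrow> 1 \<le> j \<Longrightarrow> j \<le> k \<Longrightarrow> k \<le> int (n i) \<Longrightarrow>
        spider_omega_rel l n (leg_path i j k) (leg_path i (int (n i) + 1 - k) (int (n i) + 1 - j))"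
| body: "(\<And>i. i \<in> {1..l} \<Longrightarrow> -1 \<le> k i \<and> k i \<le> int (n i)) \<Longrightarrow>
        spider_omega_rel l n (\<Union>i\<in>{1..l}. leg_path i 0 (k i))
                             (\<Union>i\<in>{1..l}. leg_path i 0 (int (n i) - 1 - k i))"

definition spider_omega :: "nat \<Rightarrow> (nat \<Rightarrow> nat) \<Rightarrow> (nat \<times> nat) set \<Rightarrow> (nat \<times> nat) set" where
  "spider_omega l n t = (THE s. spider_omega_rel l n t s)"

text \<open>\<open>spider_omega_leg\<close> and \<open>spider_omega_body\<close> show that the description is unambiguous.\<close>

lemma mem_leg_path: "(a, m) \<in> leg_path i j k \<longleftrightarrow> a = i \<and> j \<le> int m \<and> int m \<le> k"
  by (auto simp: leg_path_def)

lemma leg_path_inj: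
  assumes eq: "leg_path i j k = leg_path i' j' k'" and "0 \<le> j" "j \<le> k" "0 \<le> j'" "j' \<le> k'"
  shows "i = i' \<and> j = j' \<and> k = k'"
proof -
  have m: "(a = i \<and> j \<le> int m \<and> int m \<le> k) \<longleftrightarrow> (a = i' \<and> j' \<le> int m \<and> int m \<le> k')" for a m
    using eq by (metis mem_leg_path)
  show ?thesis
    using m[of i "nat j"] m[of i "nat k"] m[of i' "nat j'"] m[of i' "nat k'"] assms(2-5) by auto
qed

lemma body_inj:
  assumes eq: "(\<Union>i\<in>{1..l}. leg_path i 0 (k i)) = (\<Union>i\<in>{1..l}. leg_path i 0 (k' i))"
    and "i \<in> {1..l}" "-1 \<le> k i" "-1 \<le> k' i"
  shows "k i = k' i"
proof -
  have m: "int m \<le> k i \<longleftrightarrow> int m \<le> k' i" for m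
  proof -
    have "(i, m) \<in> (\<Union>i\<in>{1..l}. leg_path i 0 (k i)) \<longleftrightarrow> int m \<le> k i"
      "(i, m) \<in> (\<Union>i\<in>{1..l}. leg_path i 0 (k' i)) \<longleftrightarrow> int m \<le> k' i"
      using assms(2) by (auto simp: mem_leg_path)
    with eq show ?thesis by simp
  qed
  show ?thesis using m[of "nat (k i)"] m[of "nat (k' i)"] assms(3,4) by (auto split: if_splits)
qed

lemma leg_not_body:
  assumes "1 \<le> j" "j \<le> (k :: int)"
  shows "leg_path i j k \<noteq> (\<Union>i\<in>{1..l}. leg_path i 0 (k' i))"
proof
  assume eq: "leg_path i j k = (\<Union>i\<in>{1..l}. leg_path i 0 (k' i))"
  have "(i, nat j) \<in> leg_path i j k" using assms by (simp add: mem_leg_path)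
  with eq have "i \<in> {1..l} \<and> j \<le> k' i" using assms by (auto simp: mem_leg_path)
  then have "(i, 0) \<in> (\<Union>i\<in>{1..l}. leg_path i 0 (k' i))" using assms by (auto simp: mem_leg_path)
  with eq have "(i, 0) \<in> leg_path i j k" by simp
  with assms show False by (simp add: mem_leg_path)
qed

lemma spider_omega_leg:
  assumes "i \<in> {1..l}" "1 \<le> j" "j \<le> k" "k \<le> int (n i)"
  shows "spider_omega l n (leg_path i j k) = leg_path i (int (n i) + 1 - k) (int (n i) + 1 - j)"
  unfolding spider_omega_def
proof (rule the_equality)
  show "spider_omega_rel l n (leg_path i j k) (leg_path i (int (n i) + 1 - k) (int (n i) + 1 - j))"
    using assms by (rule spider_omega_rel.leg)
  fix s assume "spider_omega_rel l n (leg_path i j k) s"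
  then show "s = leg_path i (int (n i) + 1 - k) (int (n i) + 1 - j)"
  proof cases
    case (leg i' j' k')
    have "i = i' \<and> j = j' \<and> k = k'"
      using leg_path_inj[OF leg(1)] assms(2,3) leg(4,5) by linarith
    with leg(2) show ?thesis by simp
  next
    case (body k')
    then show ?thesis using leg_not_body[OF assms(2,3), where i=i and l=l and k'=k'] by simp
  qed
qed

lemma spider_omega_body:
  assumes "\<And>i. i \<in> {1..l} \<Longrightarrow> -1 \<le> k i \<and> k i \<le> int (n i)"
  shows "spider_omega l n (\<Union>i\<in>{1..l}. leg_path i 0 (k i)) =
         (\<Union>i\<in>{1..l}. leg_path i 0 (int (n i) - 1 - k i))"
  unfolding spider_omega_def
proof (rule the_equality)
  show "spider_omega_rel l n (\<Union>i\<in>{1..l}. leg_path i 0 (k i))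
          (\<Union>i\<in>{1..l}. leg_path i 0 (int (n i) - 1 - k i))"
    using assms by (rule spider_omega_rel.body)
  fix s assume "spider_omega_rel l n (\<Union>i\<in>{1..l}. leg_path i 0 (k i)) s"
  then show "s = (\<Union>i\<in>{1..l}. leg_path i 0 (int (n i) - 1 - k i))"
  proof cases
    case (leg i' j' k')
    then show ?thesis using leg_not_body[OF leg(4,5), where i=i' and l=l and k'=k] by simp
  next
    case (body k')
    have "k i = k' i" if "i \<in> {1..l}" for i
      using body_inj[OF body(1) that] assms[OF that] body(3)[OF that] by blast
    then show ?thesis using body(2) by simp
  qed
qed

text \<open>
  The map $\Omega$ on the tubes of a graph identified with a spider via
  \<open>\<theta> : spider l n \<rightarrow> G\<close>. It depends on this identification: a path, for instance, is a spider
  in several ways.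
\<close>

definition omega_via ::
    "nat \<Rightarrow> (nat \<Rightarrow> nat) \<Rightarrow> (nat \<times> nat \<Rightarrow> 'a) \<Rightarrow> 'a set \<Rightarrow> 'a set" where
  "omega_via l n \<theta> t = \<theta> ` spider_omega l n (inv_into (pverts (spider l n)) \<theta> ` t)"

end

theory Submission
  imports Defs
begin

text \<open>
  The link of a proper tube is the join of two complexes (tubes inside, tubes outside), each
  connected in the incompatibility relation. An isomorphism therefore either respects the two
  sides of a tube (the tube is straight) or exchanges them (flipped). Straight tubes are closed under
  subtubes and \<open>\<Phi>\<close> is induced on them by an injection of vertices; on flipped tubes \<open>\<Phi>\<close> reverses
  inclusion, compatible flipped tubes are nested, and \<open>card (\<Phi> t) = card (pverts G) - card t\<close>.
  If all tubes are straight, \<open>\<Phi>\<close> is trivial. Otherwise the vertices \<open>v\<close> with \<open>{v}\<close> flipped form the body,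
  a clique, and a tube is flipped iff it meets the body. For a flipped tube \<open>t\<close>, the image contains
  exactly those leg vertices that come from vertices neither in \<open>t\<close> nor adjacent to \<open>t\<close>; counting then
  leaves at most one way to leave a flipped tube with a single body vertex through a leg vertex, so
  the remaining vertices form paths. Finally, a flipped tube misses the end of a leg iff its image
  contains the body vertex of the corresponding leg, which identifies \<open>\<Phi>\<close> with \<open>\<Omega>\<close>.
\<close>

section \<open>Tubes and cuts\<close>

text \<open>Compatibility does not tell which of two nested tubes is the larger one; it only
  determines links. Tubes on different sides of a link are always compatible, whereas neither side
  splits into two non-empty families with all cross pairs compatible. So an isomorphism can lose
  just one bit per tube, namely which side is the inner one, and everything depends on how these
  bits vary.

  The main obstacle is that \<Phi> gives no vertex map on the body: the image of a flipped singleton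
  misses only one vertex, so it is far from a singleton. The missing part of the map is found
  dually, from the flipped tubes that miss only one vertex and are therefore sent to singletons. The
  missed vertex turns out to be the end of a leg, which explains why legs are reversed: the new body
  vertex of a leg is adjacent to the image of its far end, if the leg has any vertex outside the
  body.\<close>

definition touches :: "'a pair_pre_digraph \<Rightarrow> 'a set \<Rightarrow> 'a set \<Rightarrow> bool" where
  "touches G s t \<longleftrightarrow> (\<exists>u\<in>s. \<exists>v\<in>t. (u, v) \<in> parcs G)"

text \<open>A path from \<open>s\<close> to the rest of \<open>t\<close> crosses the cut;
  conversely, the vertices reachable inside \<open>t\<close> from a fixed one form a cut that no arc
  crosses. Later connectivity arguments all use cuts, so reachability occurs only here.\<close>

lemma tubes_iff_cuts:
  assumes "pair_graph G"
  shows "t \<in> tubes G \<longleftrightarrow>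
    t \<subseteq> pverts G \<and> t \<noteq> {} \<and> (\<forall>s. s \<subset> t \<longrightarrow> s \<noteq> {} \<longrightarrow> touches G s (t - s))"
proof -
  interpret pair_graph G by fact
  have sym: "(u, v) \<in> parcs G \<Longrightarrow> (v, u) \<in> parcs G" for u v
    using pair_sym_arcs by (auto simp: symmetric_def dest: symD)
  define r where "r = {(u, v) \<in> parcs G. u \<in> t \<and> v \<in> t}"
  have "arcs_ends (with_proj G \<restriction> t) = r"
    by (auto simp: arcs_ends_conv induce_subgraph_def with_proj_def r_def)
  moreover have "r\<^sup>s = r"
    using sym by (auto simp: symcl_def r_def)
  ultimately have conn: "connected (with_proj G \<restriction> t) \<longleftrightarrow>
      t \<noteq> {} \<and> (\<forall>u\<in>t. \<forall>v\<in>t. (u, v) \<in> rtrancl_on t r)"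
    by (simp add: connected_conv)
  have "(\<forall>u\<in>t. \<forall>v\<in>t. (u, v) \<in> rtrancl_on t r) \<longleftrightarrow>
      (\<forall>s. s \<subset> t \<longrightarrow> s \<noteq> {} \<longrightarrow> touches G s (t - s))" (is "?L \<longleftrightarrow> ?R")
  proof
    assume L: ?L
    show ?R
    proof (intro allI impI, rule ccontr)
      fix s assume s: "s \<subset> t" "s \<noteq> {}" "\<not> touches G s (t - s)"
      then obtain u v where uv: "u \<in> s" "v \<in> t - s" by blast
      then have "(u, v) \<in> rtrancl_on t r" using L s by blast
      then have "v \<in> s"
        by (induction rule: rtrancl_on_induct) (use uv s in \<open>auto simp: r_def touches_def\<close>)
      with uv show False by simp
    qed
  next
    assume R: ?R
    show ?L
    proof (intro ballI)
      fix u v assume uv: "u \<in> t" "v \<in> t"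
      define s where "s = {w \<in> t. (u, w) \<in> rtrancl_on t r}"
      have "u \<in> s" using uv by (auto simp: s_def)
      have "\<not> touches G s (t - s)"
        by (auto simp: touches_def s_def r_def intro: rtrancl_on_into_rtrancl_on)
      moreover have "s \<subseteq> t" by (auto simp: s_def)
      ultimately have "s = t" using R \<open>u \<in> s\<close> by blast
      with uv show "(u, v) \<in> rtrancl_on t r" by (auto simp: s_def)
    qed
  qed
  with conn show ?thesis by (auto simp: tubes_def)
qed

locale connected_graph =
  fixes G :: "'a pair_pre_digraph"
  assumes pair_graph: "pair_graph G" and connected: "connected (with_proj G)"
begin

lemma arc_sym: "(u, v) \<in> parcs G \<Longrightarrow> (v, u) \<in> parcs G"
  using pair_graph by (auto simp: pair_graph_def pair_pseudo_graph_def pair_sym_digraph_def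
      pair_sym_digraph_axioms_def symmetric_def dest: symD)

lemma arc_irrefl: "(u, u) \<notin> parcs G"
  using pair_loopfree_digraph.pair_no_loops[of G "(u, u)"] pair_graph
  by (auto simp: pair_graph_def pair_digraph_def)

lemma arc_verts: "(u, v) \<in> parcs G \<Longrightarrow> u \<in> pverts G \<and> v \<in> pverts G"
  using pair_wf_digraph.in_arcsD1 pair_wf_digraph.in_arcsD2 pair_graph
  by (metis pair_graph_def pair_pseudo_graph_def pair_fin_digraph_def)

lemma finite_verts: "finite (pverts G)"
  using pair_graph by (auto simp: pair_graph_def pair_pseudo_graph_def pair_fin_digraph_def
      pair_fin_digraph_axioms_def)

lemma touches_sym: "touches G s t \<longleftrightarrow> touches G t s"
  by (auto simp: touches_def intro: arc_sym)

lemma tubeI: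
  assumes "t \<subseteq> pverts G" "t \<noteq> {}" "\<And>s. s \<subset> t \<Longrightarrow> s \<noteq> {} \<Longrightarrow> touches G s (t - s)"
  shows "t \<in> tubes G"
  using assms by (simp add: tubes_iff_cuts[OF pair_graph])

lemma tube_cut: "t \<in> tubes G \<Longrightarrow> s \<subset> t \<Longrightarrow> s \<noteq> {} \<Longrightarrow> touches G s (t - s)"
  by (simp add: tubes_iff_cuts[OF pair_graph])

lemma tube_cut_obtain:
  assumes "t \<in> tubes G" "s \<subset> t" "s \<noteq> {}"
  obtains u v where "u \<in> s" "v \<in> t" "v \<notin> s" "(u, v) \<in> parcs G"
  using tube_cut[OF assms] by (auto simp: touches_def)

lemma tube_subset: "t \<in> tubes G \<Longrightarrow> t \<subseteq> pverts G"
  and tube_nonempty: "t \<in> tubes G \<Longrightarrow> t \<noteq> {}"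
  by (auto simp: tubes_def)

lemma singleton_tube: "v \<in> pverts G \<Longrightarrow> {v} \<in> tubes G"
  by (rule tubeI) auto

lemma verts_tube: "pverts G \<in> tubes G"
proof -
  have "with_proj G \<restriction> pverts G = with_proj G"
    using arc_verts by (auto simp: induce_subgraph_def with_proj_def)
  moreover have "pverts G \<noteq> {}"
    using connected by (auto simp: connected_conv)
  ultimately show ?thesis using connected by (simp add: tubes_def)
qed

lemma tube_Un:
  assumes s: "s \<in> tubes G" and t: "t \<in> tubes G" and "s \<inter> t \<noteq> {} \<or> touches G s t"
  shows "s \<union> t \<in> tubes G"
proof (rule tubeI)
  fix r assume r: "r \<subset> s \<union> t" "r \<noteq> {}"
  show "touches G r (s \<union> t - r)"
  proof (rule ccontr)
    assume no: "\<not> touches G r (s \<union> t - r)"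
    \<comment> \<open>A tube cannot straddle the uncrossed cut \<open>r\<close>. Hence one of
      \<open>s\<close>, \<open>t\<close> lies in \<open>r\<close> and the other outside, so they are
      disjoint and the arc between them crosses \<open>r\<close>.\<close>
    have pure: "x \<subseteq> r \<or> x \<inter> r = {}" if x: "x \<in> tubes G" "x \<subseteq> s \<union> t" for x
    proof (rule ccontr)
      assume "\<not> ?thesis"
      then have "touches G (x \<inter> r) (x - x \<inter> r)" by (intro tube_cut x) auto
      with no x show False by (auto simp: touches_def)
    qed
    have "s \<subseteq> r \<and> t \<inter> r = {} \<and> touches G s t \<or> t \<subseteq> r \<and> s \<inter> r = {} \<and> touches G t s"
      using pure[OF s] pure[OF t] assms(3) r touches_sym[of s t] by blast
    with no show False by (auto simp: touches_def)
  qed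
qed (use tube_subset[OF s] tube_subset[OF t] tube_nonempty[OF s] in auto)

lemma tube_insert:
  assumes "s \<in> tubes G" "u \<in> s" "(u, v) \<in> parcs G"
  shows "insert v s \<in> tubes G"
  using tube_Un[OF assms(1) singleton_tube[of v]] assms arc_verts by (auto simp: touches_def)

text \<open>The union of disjoint tubes is connected exactly if an arc joins them, so the condition
  on the union can be traded for non-adjacency.\<close>

lemma tube_compatible_iff:
  assumes "s \<in> tubes G" "t \<in> tubes G"
  shows "tube_compatible G s t \<longleftrightarrow> s \<subseteq> t \<or> t \<subseteq> s \<or> (s \<inter> t = {} \<and> \<not> touches G s t)"
proof -
  have "s \<union> t \<notin> tubes G" if "s \<inter> t = {}" "\<not> touches G s t"
  proof
    assume "s \<union> t \<in> tubes G"
    then have "touches G s (s \<union> t - s)"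
      using that tube_nonempty[OF assms(1)] tube_nonempty[OF assms(2)] by (intro tube_cut) auto
    with that show False by (auto simp: touches_def)
  qed
  moreover have "s \<union> t \<in> tubes G" if "touches G s t"
    using tube_Un[OF assms] that by simp
  ultimately show ?thesis by (metis tube_compatible_def)
qed

section \<open>Proper tubes and the two sides of a link\<close>

lemma proper_tubes_iff: "t \<in> proper_tubes G \<longleftrightarrow> t \<in> tubes G \<and> t \<noteq> pverts G"
proof
  assume "t \<in> proper_tubes G"
  then obtain s where "t \<in> tubes G" "s \<in> tubes G" "t \<subset> s"
    unfolding proper_tubes_def by blast
  with tube_subset[of s] show "t \<in> tubes G \<and> t \<noteq> pverts G" by blast
next
  assume t: "t \<in> tubes G \<and> t \<noteq> pverts G"
  then have "t \<subset> pverts G" using tube_subset by blast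
  with t verts_tube show "t \<in> proper_tubes G" unfolding proper_tubes_def by blast
qed

lemma proper_tube_tube: "t \<in> proper_tubes G \<Longrightarrow> t \<in> tubes G"
  by (simp add: proper_tubes_iff)

text \<open>For a connected graph, the link of a proper tube in the nested complex is the join of
  the following two sets.\<close>

definition inner :: "'a set \<Rightarrow> 'a set set" where
  "inner t = {s \<in> proper_tubes G. s \<subset> t}"

definition outer :: "'a set \<Rightarrow> 'a set set" where
  "outer t = {s \<in> proper_tubes G. t \<subset> s \<or> (s \<inter> t = {} \<and> \<not> touches G s t)}"

lemma link_eq:
  assumes "t \<in> proper_tubes G"
  shows "{s \<in> proper_tubes G. s \<noteq> t \<and> tube_compatible G s t} = inner t \<union> outer t"
  using assms tube_compatible_iff[OF proper_tube_tube proper_tube_tube] tube_nonempty[OF proper_tube_tube]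
  by (auto simp: inner_def outer_def)

lemma inner_outer_disjoint: "inner t \<inter> outer t = {}"
  by (auto simp: inner_def outer_def dest: proper_tube_tube tube_nonempty)

text \<open>Both kinds of outer position, containing \<open>t\<close> and being separated from
  \<open>t\<close>, are inherited by subsets of \<open>t\<close>.\<close>

lemma inner_outer_compatible:
  assumes "s \<in> inner t" "r \<in> outer t"
  shows "tube_compatible G s r"
proof -
  have "s \<in> tubes G" "r \<in> tubes G" using assms by (auto simp: inner_def outer_def proper_tube_tube)
  with assms show ?thesis using touches_sym[of r t]
    by (auto simp: tube_compatible_iff inner_def outer_def touches_def)
qed

lemma singleton_incompatible:
  assumes "t \<in> tubes G" "u \<in> t" "v \<notin> t" "(u, v) \<in> parcs G"
  shows "\<not> tube_compatible G {v} t" "\<not> tube_compatible G t {v}"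
proof -
  have "{v} \<in> tubes G" using assms arc_verts by (auto intro: singleton_tube)
  then show "\<not> tube_compatible G {v} t"
    using assms arc_sym by (auto simp: tube_compatible_iff touches_def)
  then show "\<not> tube_compatible G t {v}"
    by (simp add: tube_compatible_sym)
qed

text \<open>Singletons of adjacent vertices are incompatible, so the singletons inside the connected
  set \<open>t\<close> are linked to each other; every inner tube is incompatible with the singleton
  of a neighbouring vertex of \<open>t\<close>. Hence no \<open>X\<close> can separate them.\<close>

lemma inner_linked:
  assumes t: "t \<in> proper_tubes G" and X: "X \<subset> inner t" "X \<noteq> {}"
  obtains x y where "x \<in> X" "y \<in> inner t - X" "\<not> tube_compatible G x y"
proof (rule ccontr)
  assume "\<not> thesis"
  with that have comp: "tube_compatible G x y" "tube_compatible G y x"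
    if "x \<in> X" "y \<in> inner t - X" for x y
    using that tube_compatible_sym by blast+
  have tt: "t \<in> tubes G" using t by (rule proper_tube_tube)
  obtain a where a: "a \<in> inner t" using X by blast
  have sub: "s \<in> tubes G" "s \<subset> t" if "s \<in> inner t" for s
    using that by (auto simp: inner_def proper_tube_tube)
  have sing: "{v} \<in> inner t" if "v \<in> t" for v
  proof -
    have "{v} \<noteq> t" using sub[OF a] tube_nonempty by blast
    moreover have "{v} \<in> tubes G" using that tube_subset[OF tt] by (auto intro: singleton_tube)
    moreover have "{v} \<noteq> pverts G" using calculation tube_subset[OF tt] that by auto
    ultimately show ?thesis using that by (auto simp: inner_def proper_tubes_iff)
  qed
  have cov: "\<exists>v\<in>t. v \<notin> s \<and> \<not> tube_compatible G {v} s" if "s \<in> inner t" for s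
    using tube_cut_obtain[OF tt sub(2)[OF that] tube_nonempty[OF sub(1)[OF that]]]
      singleton_incompatible[OF sub(1)[OF that]] by metis
  define S where "S = {v \<in> t. {v} \<in> X}"
  have "S = {} \<or> S = t"
  proof (rule ccontr)
    assume "\<not> ?thesis"
    then obtain u v where uv: "u \<in> S" "v \<in> t" "v \<notin> S" "(u, v) \<in> parcs G"
      using tube_cut_obtain[OF tt, of S] by (auto simp: S_def)
    then have "tube_compatible G {u} {v}" using sing comp by (auto simp: S_def)
    moreover have "{u} \<in> tubes G" using uv arc_verts by (auto intro: singleton_tube)
    ultimately show False using singleton_incompatible[of "{u}" u v] uv arc_irrefl by auto
  qed
  moreover obtain x y where "x \<in> X" "y \<in> inner t - X" using X by blast
  ultimately show False using cov[of x] cov[of y] comp sing X unfolding S_def by blast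
qed

text \<open>The pattern of \<open>inner_linked\<close>, after contraction of \<open>t\<close>:
  \<open>atom v\<close> is the smallest candidate for an outer tube containing \<open>v\<close>. Two
  atoms are incompatible if their vertices are adjacent or both adjacent to \<open>t\<close>; these
  are the arcs of the reconnected complement of \<open>t\<close>, and that graph is
  connected.\<close>

lemma outer_linked:
  assumes t: "t \<in> proper_tubes G" and X: "X \<subset> outer t" "X \<noteq> {}"
  obtains x y where "x \<in> X" "y \<in> outer t - X" "\<not> tube_compatible G x y"
proof (rule ccontr)
  assume "\<not> thesis"
  with that have comp: "tube_compatible G x y" "tube_compatible G y x"
    if "x \<in> X" "y \<in> outer t - X" for x y
    using that tube_compatible_sym by blast+
  have tt: "t \<in> tubes G" using t by (rule proper_tube_tube)
  have sub: "s \<in> tubes G" "s \<subseteq> pverts G" "s \<noteq> {}" "s \<noteq> pverts G" if "s \<in> outer t" for s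
    using that tube_subset[of s] tube_nonempty[of s] by (auto simp: outer_def proper_tubes_iff)
  define atom where "atom v = (if touches G t {v} then insert v t else {v})" for v
  have atom_tube: "atom v \<in> tubes G" if "v \<in> pverts G" for v
    using that tube_insert[OF tt, of _ v] by (auto simp: atom_def touches_def intro: singleton_tube)
  obtain a where a: "a \<in> outer t" using X by blast
  have atom_outer: "atom v \<in> outer t" if "v \<in> pverts G - t" for v
  proof -
    \<comment> \<open>Some outer tube \<open>a\<close> exists because \<open>X\<close> is non-empty.
      If \<open>t\<close> missed only \<open>v\<close>, then \<open>a\<close> would be either all of
      \<open>G\<close> or the set \<open>{v}\<close> without an arc to \<open>t\<close>, against
      connectedness.\<close>
    have "insert v t \<noteq> pverts G"
    proof
      assume eq: "insert v t = pverts G"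
      from a consider "t \<subset> a" | "a \<inter> t = {}" "\<not> touches G a t" by (auto simp: outer_def)
      then show False
      proof cases
        case 1
        then obtain x where "x \<in> a" "x \<notin> t" by blast
        with eq sub[OF a] have "x = v" by blast
        with 1 \<open>x \<in> a\<close> have "insert v t \<subseteq> a" by blast
        with eq sub[OF a] show False by auto
      next
        case 2
        with eq sub[OF a] have "a = {v}" by auto
        moreover have "pverts G - t = {v}" using eq that by auto
        ultimately have "\<not> touches G t (pverts G - t)" using 2 touches_sym by simp
        with tube_cut[OF verts_tube, of t] tube_subset[OF tt] tube_nonempty[OF tt] that
        show False by auto
      qed
    qed
    moreover have "{v} \<noteq> pverts G" using that tube_subset[OF tt] tube_nonempty[OF tt] by auto
    ultimately show ?thesis using that atom_tube[of v] touches_sym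
      by (auto simp: outer_def proper_tubes_iff atom_def split: if_splits)
  qed
  have atom_incomp: "\<not> tube_compatible G (atom v) (atom w)"
    if vw: "v \<in> pverts G - t" "w \<in> pverts G - t" "v \<noteq> w"
      "(v, w) \<in> parcs G \<or> touches G t {v} \<and> touches G t {w}" for v w
    using vw atom_tube[of v] atom_tube[of w] arc_sym[of v w] tube_nonempty[OF tt]
    by (auto simp: tube_compatible_iff atom_def touches_def)
  have cov: "\<exists>v\<in>pverts G - t. \<not> tube_compatible G (atom v) s" if s: "s \<in> outer t" for s
  proof -
    obtain u v where uv: "u \<in> s" "v \<in> pverts G" "v \<notin> s" "(u, v) \<in> parcs G"
      using tube_cut_obtain[OF verts_tube, of s] sub[OF s] by blast
    have "v \<notin> t" using s uv by (auto simp: outer_def touches_def)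
    moreover have "\<not> tube_compatible G (atom v) s"
      using s uv sub[OF s] atom_tube[OF uv(2)] arc_sym[OF uv(4)] tube_nonempty[OF tt]
      by (auto simp: tube_compatible_iff atom_def outer_def touches_def)
    ultimately show ?thesis using uv by blast
  qed
  define S where "S = {v \<in> pverts G - t. atom v \<in> X}"
  have "S = {} \<or> S = pverts G - t"
  proof (rule ccontr)
    assume S: "\<not> ?thesis"
    have sep: "(v, w) \<notin> parcs G \<and> \<not> (touches G t {v} \<and> touches G t {w})"
      if "v \<in> S" "w \<in> pverts G - t - S" for v w
      using atom_incomp[of v w] comp(1)[of "atom v" "atom w"] atom_outer that
      by (auto simp: S_def)
    \<comment> \<open>A set outside \<open>t\<close> with no arc to the rest of the outside can be
      left only towards \<open>t\<close>. For \<open>S\<close> and its complement outside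
      \<open>t\<close> this yields two vertices next to \<open>t\<close>, whose atoms are
      incompatible.\<close>
    have exit: "\<exists>v\<in>R. touches G t {v}"
      if R: "R \<noteq> {}" "R \<subseteq> pverts G - t" "\<And>v w. v \<in> R \<Longrightarrow> w \<in> pverts G - t - R \<Longrightarrow> (v, w) \<notin> parcs G" for R
    proof -
      have "R \<subset> pverts G" using R(2) tube_subset[OF tt] tube_nonempty[OF tt] by blast
      then obtain v w where vw: "v \<in> R" "w \<in> pverts G" "w \<notin> R" "(v, w) \<in> parcs G"
        using tube_cut_obtain[OF verts_tube _ R(1)] by blast
      with R(3) have "w \<in> t" by blast
      with vw arc_sym show ?thesis unfolding touches_def by blast
    qed
    have "\<exists>v\<in>S. touches G t {v}"
      using S sep by (intro exit) (auto simp: S_def)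
    moreover have "\<exists>w\<in>pverts G - t - S. touches G t {w}"
    proof (rule exit)
      show "pverts G - t - S \<noteq> {}" using S by (auto simp: S_def)
      show "(v, w) \<notin> parcs G" if "v \<in> pverts G - t - S" "w \<in> pverts G - t - (pverts G - t - S)" for v w
        using sep[of w v] that arc_sym by blast
    qed auto
    ultimately show False using sep by blast
  qed
  moreover obtain x y where "x \<in> X" "y \<in> outer t - X" using X by blast
  ultimately show False using cov[of x] cov[of y] comp atom_outer X unfolding S_def by blast
qed

lemma singleton_proper:
  assumes "t \<in> proper_tubes G" "v \<in> pverts G"
  shows "{v} \<in> proper_tubes G"
proof -
  have "t \<subseteq> pverts G" "t \<noteq> {}" "t \<noteq> pverts G"
    using assms by (simp_all add: proper_tubes_iff tube_subset tube_nonempty)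
  then have "{v} \<noteq> pverts G" using subset_singletonD by metis
  then show ?thesis using assms(2) by (simp add: proper_tubes_iff singleton_tube)
qed

lemma proper_tube_subset: "t \<in> proper_tubes G \<Longrightarrow> t \<subset> pverts G"
  using tube_subset by (auto simp: proper_tubes_iff)

lemma proper_tube_nonempty: "t \<in> proper_tubes G \<Longrightarrow> t \<noteq> {}"
  by (auto simp: proper_tubes_iff tube_nonempty)

lemma finite_proper_tube: "t \<in> proper_tubes G \<Longrightarrow> finite t"
  using proper_tube_subset finite_verts finite_subset by (metis psubsetE)

lemma subtube_proper: "t \<in> proper_tubes G \<Longrightarrow> s \<in> tubes G \<Longrightarrow> s \<subseteq> t \<Longrightarrow> s \<in> proper_tubes G"
  using proper_tube_subset by (auto simp: proper_tubes_iff)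

section \<open>Changing tubes by one vertex\<close>

text \<open>A maximal subtube \<open>s\<close> of \<open>t\<close> that contains \<open>b\<close>
  and differs from \<open>t\<close> grows by a neighbour within \<open>t\<close>; by maximality the
  result is \<open>t\<close>, so \<open>s\<close> misses one vertex.\<close>

lemma tube_remove_vertex:
  assumes t: "t \<in> tubes G" "b \<in> t" "t \<noteq> {b}"
  obtains x where "x \<in> t" "x \<noteq> b" "t - {x} \<in> tubes G"
proof -
  define F where "F = {s \<in> tubes G. b \<in> s \<and> s \<subset> t}"
  have "t \<subseteq> pverts G" using t(1) by (rule tube_subset)
  then have "finite F" using finite_verts unfolding F_def
    by (intro finite_subset[OF _ finite_Pow_iff[THEN iffD2, of "pverts G"]]) auto
  moreover have "{b} \<in> F" using t \<open>t \<subseteq> pverts G\<close> by (auto simp: F_def intro: singleton_tube)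
  ultimately obtain s where s: "s \<in> F" and max: "\<And>r. r \<in> F \<Longrightarrow> s \<subseteq> r \<Longrightarrow> s = r"
    using finite_has_maximal[of F] by blast
  have s': "s \<in> tubes G" "b \<in> s" "s \<subset> t" using s by (auto simp: F_def)
  then obtain u x where x: "u \<in> s" "x \<in> t" "x \<notin> s" "(u, x) \<in> parcs G"
    using tube_cut_obtain[OF t(1), of s] by blast
  have "insert x s \<in> tubes G" using tube_insert[OF s'(1) x(1) x(4)] .
  then have "insert x s = t" using max[of "insert x s"] x s' by (auto simp: F_def)
  then have "t - {x} = s" using x by blast
  with s' x show thesis by (intro that) auto
qed

lemma proper_tube_grow:
  assumes t: "t \<in> proper_tubes G"
  obtains x where "x \<in> pverts G" "x \<notin> t" "touches G t {x}" "insert x t \<in> tubes G"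
proof -
  obtain u x where x: "u \<in> t" "x \<in> pverts G" "x \<notin> t" "(u, x) \<in> parcs G"
    using tube_cut_obtain[OF verts_tube proper_tube_subset[OF t] proper_tube_nonempty[OF t]] by blast
  moreover have "insert x t \<in> tubes G"
    using tube_insert[OF proper_tube_tube[OF t] x(1) x(4)] .
  ultimately show thesis by (intro that) (auto simp: touches_def)
qed

lemma singletons_compatible_iff:
  assumes "u \<in> pverts G" "v \<in> pverts G" "u \<noteq> v"
  shows "tube_compatible G {u} {v} \<longleftrightarrow> (u, v) \<notin> parcs G"
  using assms by (simp add: tube_compatible_iff singleton_tube touches_def)

end


section \<open>Straight and flipped tubes\<close>

text \<open>The inverse \<Gamma> is a parameter to make the assumptions symmetric: through
  \<open>converse\<close>, facts about \<Phi> hold for \<Gamma> too, under the prefix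
  \<open>conv\<close>. The context is reopened where new facts are wanted for \<Gamma> as
  well.\<close>

locale nested_complex_iso = src: connected_graph G + tgt: connected_graph G'
  for G :: "'a pair_pre_digraph" and G' :: "'b pair_pre_digraph" +
  fixes \<Phi> :: "'a set \<Rightarrow> 'b set" and \<Gamma> :: "'b set \<Rightarrow> 'a set"
  assumes map_proper: "t \<in> proper_tubes G \<Longrightarrow> \<Phi> t \<in> proper_tubes G'"
    and inv_proper: "t' \<in> proper_tubes G' \<Longrightarrow> \<Gamma> t' \<in> proper_tubes G"
    and inv_map: "t \<in> proper_tubes G \<Longrightarrow> \<Gamma> (\<Phi> t) = t"
    and map_inv: "t' \<in> proper_tubes G' \<Longrightarrow> \<Phi> (\<Gamma> t') = t'"
    and compatible_iff: "s \<in> proper_tubes G \<Longrightarrow> t \<in> proper_tubes G \<Longrightarrow>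
      tube_compatible G s t \<longleftrightarrow> tube_compatible G' (\<Phi> s) (\<Phi> t)"
begin

lemma converse: "nested_complex_iso G' G \<Gamma> \<Phi>"
  by unfold_locales (auto simp: map_proper inv_proper inv_map map_inv compatible_iff)

section \<open>Each tube is straight or flipped\<close>

text \<open>A proper tube with empty link, which occurs only if \<open>G\<close> has two vertices,
  is straight by vacuity; isomorphisms are indeed trivial there.\<close>

definition straight :: "'a set \<Rightarrow> bool" where
  "straight t \<longleftrightarrow> \<Phi> ` src.inner t \<subseteq> tgt.inner (\<Phi> t) \<and> \<Phi> ` src.outer t \<subseteq> tgt.outer (\<Phi> t)"

lemma map_link:
  assumes t: "t \<in> proper_tubes G" and s: "s \<in> src.inner t \<union> src.outer t"
  shows "\<Phi> s \<in> tgt.inner (\<Phi> t) \<union> tgt.outer (\<Phi> t)"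
proof -
  have s': "s \<in> proper_tubes G" "s \<noteq> t" "tube_compatible G s t"
    using s src.link_eq[OF t] by auto
  then have "\<Phi> s \<noteq> \<Phi> t" using inv_map t by metis
  then show ?thesis using s' t tgt.link_eq[OF map_proper[OF t]] map_proper[OF s'(1)] compatible_iff by blast
qed

text \<open>If some inner tubes were sent inside and others outside, the two groups would be
  compatible throughout, against \<open>inner_linked\<close>.\<close>

lemma map_inner_one_side:
  assumes t: "t \<in> proper_tubes G"
  shows "\<Phi> ` src.inner t \<subseteq> tgt.inner (\<Phi> t) \<or> \<Phi> ` src.inner t \<subseteq> tgt.outer (\<Phi> t)"
proof (rule ccontr)
  assume neg: "\<not> ?thesis"
  define X where "X = {s \<in> src.inner t. \<Phi> s \<in> tgt.inner (\<Phi> t)}"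
  have out: "\<Phi> s \<in> tgt.outer (\<Phi> t)" if "s \<in> src.inner t - X" for s
    using map_link[OF t, of s] that by (auto simp: X_def)
  have "X \<subset> src.inner t" "X \<noteq> {}"
    using neg map_link[OF t] by (auto simp: X_def)
  then obtain x y where xy: "x \<in> X" "y \<in> src.inner t - X" "\<not> tube_compatible G x y"
    using src.inner_linked[OF t] by blast
  moreover have "tube_compatible G' (\<Phi> x) (\<Phi> y)"
    using xy out[of y] by (intro tgt.inner_outer_compatible[of _ "\<Phi> t"]) (auto simp: X_def)
  moreover have "x \<in> proper_tubes G" "y \<in> proper_tubes G"
    using xy by (auto simp: X_def src.inner_def)
  ultimately show False using compatible_iff by blast
qed

lemma map_outer_one_side:
  assumes t: "t \<in> proper_tubes G"
  shows "\<Phi> ` src.outer t \<subseteq> tgt.inner (\<Phi> t) \<or> \<Phi> ` src.outer t \<subseteq> tgt.outer (\<Phi> t)"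
proof (rule ccontr)
  assume neg: "\<not> ?thesis"
  define X where "X = {s \<in> src.outer t. \<Phi> s \<in> tgt.inner (\<Phi> t)}"
  have out: "\<Phi> s \<in> tgt.outer (\<Phi> t)" if "s \<in> src.outer t - X" for s
    using map_link[OF t, of s] that by (auto simp: X_def)
  have "X \<subset> src.outer t" "X \<noteq> {}"
    using neg map_link[OF t] by (auto simp: X_def)
  then obtain x y where xy: "x \<in> X" "y \<in> src.outer t - X" "\<not> tube_compatible G x y"
    using src.outer_linked[OF t] by blast
  moreover have "tube_compatible G' (\<Phi> x) (\<Phi> y)"
    using xy out[of y] by (intro tgt.inner_outer_compatible[of _ "\<Phi> t"]) (auto simp: X_def)
  moreover have "x \<in> proper_tubes G" "y \<in> proper_tubes G"
    using xy by (auto simp: X_def src.outer_def)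
  ultimately show False using compatible_iff by blast
qed

end

context nested_complex_iso
begin

interpretation conv: nested_complex_iso G' G \<Gamma> \<Phi>
  by (rule converse)

text \<open>It remains to exclude that members of both sides land on one side of
  \<open>\<Phi> t\<close>. From there \<Gamma> would lead back to both sides of \<open>t\<close>,
  against its own one-sidedness.\<close>

lemma straight_or_flipped:
  assumes t: "t \<in> proper_tubes G"
  shows "straight t \<or>
    \<Phi> ` src.inner t \<subseteq> tgt.outer (\<Phi> t) \<and> \<Phi> ` src.outer t \<subseteq> tgt.inner (\<Phi> t)"
proof -
  have same: False
    if ab: "a \<in> src.inner t" "b \<in> src.outer t"
      and side: "\<Phi> a \<in> tgt.inner (\<Phi> t) \<and> \<Phi> b \<in> tgt.inner (\<Phi> t) \<or>
        \<Phi> a \<in> tgt.outer (\<Phi> t) \<and> \<Phi> b \<in> tgt.outer (\<Phi> t)" for a b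
  proof -
    have returns: "\<Gamma> (\<Phi> a) = a" "\<Gamma> (\<Phi> b) = b"
      using ab inv_map by (simp_all add: src.inner_def src.outer_def)
    have "\<Gamma> (\<Phi> a) \<in> src.inner t \<and> \<Gamma> (\<Phi> b) \<in> src.inner t \<or>
        \<Gamma> (\<Phi> a) \<in> src.outer t \<and> \<Gamma> (\<Phi> b) \<in> src.outer t"
      using side conv.map_inner_one_side[OF map_proper[OF t]]
        conv.map_outer_one_side[OF map_proper[OF t]] unfolding inv_map[OF t] by blast
    then have "a \<in> src.inner t \<and> b \<in> src.inner t \<or> a \<in> src.outer t \<and> b \<in> src.outer t"
      unfolding returns .
    with ab show False using src.inner_outer_disjoint by blast
  qed
  show ?thesis
    using map_inner_one_side[OF t] map_outer_one_side[OF t] same unfolding straight_def by blast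
qed

lemma straight_imp_conv:
  assumes t: "t \<in> proper_tubes G" "straight t"
  shows "conv.straight (\<Phi> t)"
proof -
  have "s \<in> tgt.inner (\<Phi> t) \<longleftrightarrow> \<Gamma> s \<in> src.inner t" if "s \<in> tgt.inner (\<Phi> t) \<union> tgt.outer (\<Phi> t)" for s
  proof -
    have "\<Gamma> s \<in> src.inner t \<union> src.outer t"
      using conv.map_link[OF map_proper[OF t(1)] that] inv_map[OF t(1)] by simp
    moreover have "\<Phi> (\<Gamma> s) = s" using that map_inv by (auto simp: tgt.inner_def tgt.outer_def)
    ultimately show ?thesis
      using t(2) tgt.inner_outer_disjoint[of "\<Phi> t"] src.inner_outer_disjoint[of t]
      unfolding straight_def by (metis Un_iff disjoint_iff image_subset_iff)
  qed
  moreover have "\<Gamma> s \<in> src.inner t \<union> src.outer t" if "s \<in> tgt.inner (\<Phi> t) \<union> tgt.outer (\<Phi> t)" for s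
    using conv.map_link[OF map_proper[OF t(1)] that] inv_map[OF t(1)] by simp
  ultimately show ?thesis
    using inv_map[OF t(1)] tgt.inner_outer_disjoint[of "\<Phi> t"] unfolding conv.straight_def by auto
qed

end

context nested_complex_iso
begin

interpretation conv: nested_complex_iso G' G \<Gamma> \<Phi>
  by (rule converse)

lemma straight_conv_iff: "t \<in> proper_tubes G \<Longrightarrow> conv.straight (\<Phi> t) \<longleftrightarrow> straight t"
  using straight_imp_conv conv.straight_imp_conv[of "\<Phi> t"] map_proper inv_map by fastforce

section \<open>Inclusion and separation under straight and flipped tubes\<close>

lemma flipped_inner:
  assumes "t \<in> proper_tubes G" "\<not> straight t" "s \<in> proper_tubes G" "s \<subset> t"
  shows "\<Phi> s \<in> tgt.outer (\<Phi> t)"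
  using straight_or_flipped[OF assms(1)] assms by (auto simp: src.inner_def)

lemma flipped_outer:
  assumes "t \<in> proper_tubes G" "\<not> straight t" "s \<in> src.outer t"
  shows "\<Phi> s \<subset> \<Phi> t"
  using straight_or_flipped[OF assms(1)] assms by (auto simp: tgt.inner_def)

text \<open>A flipped \<open>s\<close> would reverse the inclusion between \<open>s\<close> and
  \<open>t\<close>, while straightness of \<open>t\<close> preserves it.\<close>

lemma straight_subset:
  assumes t: "t \<in> proper_tubes G" "straight t" and s: "s \<in> proper_tubes G" "s \<subseteq> t"
  shows "straight s" "\<Phi> s \<subseteq> \<Phi> t"
proof -
  have "straight s \<and> \<Phi> s \<subseteq> \<Phi> t"
  proof (cases "s = t")
    case False
    then have "s \<in> src.inner t" "t \<in> src.outer s"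
      using t s by (auto simp: src.inner_def src.outer_def)
    then have "\<Phi> s \<subset> \<Phi> t" using t(2) by (auto simp: straight_def tgt.inner_def)
    then show ?thesis using flipped_outer[OF s(1) _ \<open>t \<in> src.outer s\<close>] by blast
  qed (use t in simp)
  then show "straight s" "\<Phi> s \<subseteq> \<Phi> t" by auto
qed

lemma flipped_superset:
  assumes t: "t \<in> proper_tubes G" and s: "s \<in> proper_tubes G" "\<not> straight s" "s \<subseteq> t"
  shows "\<not> straight t" "\<Phi> t \<subseteq> \<Phi> s"
proof -
  show "\<not> straight t" using straight_subset(1)[OF t _ s(1,3)] s(2) by blast
  show "\<Phi> t \<subseteq> \<Phi> s"
  proof (cases "s = t")
    case False
    then have "t \<in> src.outer s" using t s by (auto simp: src.outer_def)
    then show ?thesis using flipped_outer[OF s(1,2)] by blast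
  qed simp
qed

end

context nested_complex_iso
begin

interpretation conv: nested_complex_iso G' G \<Gamma> \<Phi>
  by (rule converse)

lemma flipped_subset_iff:
  assumes "s \<in> proper_tubes G" "\<not> straight s" "t \<in> proper_tubes G" "\<not> straight t"
  shows "\<Phi> t \<subseteq> \<Phi> s \<longleftrightarrow> s \<subseteq> t"
  using flipped_superset[OF assms(3,1,2)] straight_conv_iff[OF assms(3)] assms inv_map
    conv.flipped_superset(2)[OF map_proper[OF assms(1)] map_proper[OF assms(3)]] by metis

text \<open>Two separated flipped tubes would each lie outside the other, so each image would be
  strictly contained in the other.\<close>

lemma flipped_compatible_nested:
  assumes "s \<in> proper_tubes G" "\<not> straight s" "t \<in> proper_tubes G" "\<not> straight t"
    "tube_compatible G s t"
  shows "s \<subseteq> t \<or> t \<subseteq> s"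
proof (rule ccontr)
  assume "\<not> ?thesis"
  then have "s \<in> src.outer t" "t \<in> src.outer s"
    using assms src.touches_sym[of s t]
    by (auto simp: src.tube_compatible_iff src.proper_tube_tube src.outer_def)
  then have "\<Phi> s \<subset> \<Phi> t" "\<Phi> t \<subset> \<Phi> s"
    using flipped_outer assms by blast+
  then show False by blast
qed

lemma straight_flipped_separate:
  assumes t: "t \<in> proper_tubes G" "\<not> straight t" and s: "s \<in> proper_tubes G" "straight s"
    and st: "s \<inter> t = {}" "\<not> touches G s t"
  shows "\<Phi> s \<subset> \<Phi> t"
  using flipped_outer[OF t] s st by (auto simp: src.outer_def)

text \<open>\<open>\<Phi> s\<close> is on the outer side of \<open>\<Phi> t\<close>. It cannot
  contain \<open>\<Phi> t\<close>: being straight for \<Gamma>, it would carry that inclusion back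
  to \<open>t \<subseteq> s\<close>.\<close>

lemma straight_flipped_subset:
  assumes t: "t \<in> proper_tubes G" "\<not> straight t" and s: "s \<in> proper_tubes G" "straight s"
    and st: "s \<subseteq> t"
  shows "\<Phi> s \<inter> \<Phi> t = {}" "\<not> touches G' (\<Phi> s) (\<Phi> t)"
proof -
  have "s \<subset> t" using assms by blast
  have "\<not> \<Phi> t \<subseteq> \<Phi> s"
    using conv.straight_subset(2)[of "\<Phi> s" "\<Phi> t"] straight_conv_iff[of s] map_proper inv_map s t
      \<open>s \<subset> t\<close> by auto
  with flipped_inner[OF t s(1) \<open>s \<subset> t\<close>] show "\<Phi> s \<inter> \<Phi> t = {}" "\<not> touches G' (\<Phi> s) (\<Phi> t)"
    by (auto simp: tgt.outer_def)
qed

section \<open>Body and legs\<close>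

definition body :: "'a set" where
  "body = {v \<in> pverts G. \<not> straight {v}}"

definition legs :: "'a set" where
  "legs = {v \<in> pverts G. straight {v}}"

lemma body_Un_legs: "body \<union> legs = pverts G" and body_Int_legs: "body \<inter> legs = {}"
  by (auto simp: body_def legs_def)

text \<open>In the critical case all proper subtubes of \<open>t\<close> are straight and
  \<open>t\<close> is not a singleton. The image of a vertex of \<open>t\<close> stays apart from
  \<open>\<Phi> t\<close>, which leaves room to enlarge \<open>\<Phi> t\<close> by a vertex without
  filling \<open>G'\<close>. The preimage of the enlarged tube lies strictly inside
  \<open>t\<close>, hence is straight, hence should have an image disjoint from
  \<open>\<Phi> t\<close>.\<close>

lemma flipped_imp_meets_body:
  assumes "t \<in> proper_tubes G" "\<not> straight t"
  shows "t \<inter> body \<noteq> {}"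
  using assms
proof (induction "card t" arbitrary: t rule: less_induct)
  case less
  note t = less.prems
  show ?case
  proof (cases "\<exists>s\<in>src.inner t. \<not> straight s")
    case True
    then obtain s where s: "s \<in> proper_tubes G" "s \<subset> t" "\<not> straight s"
      by (auto simp: src.inner_def)
    have "card s < card t" using s src.finite_proper_tube[OF t(1)] psubset_card_mono by blast
    with less.hyps s show ?thesis by blast
  next
    case False
    obtain v where v: "v \<in> t" "v \<in> pverts G"
      using src.proper_tube_nonempty[OF t(1)] src.proper_tube_subset[OF t(1)] by blast
    show ?thesis
    proof (cases "t = {v}")
      case True
      with t v show ?thesis by (auto simp: body_def)
    next
      case neq: False
      have v': "{v} \<in> proper_tubes G" using src.singleton_proper[OF t(1) v(2)] .
      then have "straight {v}" using False neq v by (auto simp: src.inner_def)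
      then have sep: "\<Phi> {v} \<inter> \<Phi> t = {}" "\<not> touches G' (\<Phi> {v}) (\<Phi> t)"
        using straight_flipped_subset[OF t v'] v by auto
      obtain x where x: "x \<in> pverts G'" "x \<notin> \<Phi> t" "touches G' (\<Phi> t) {x}"
          "insert x (\<Phi> t) \<in> tubes G'"
        using tgt.proper_tube_grow[OF map_proper[OF t(1)]] .
      have "x \<notin> \<Phi> {v}" using sep(2) x(3) tgt.touches_sym[of "\<Phi> {v}" "\<Phi> t"]
        by (auto simp: touches_def)
      obtain y where "y \<in> \<Phi> {v}" using tgt.proper_tube_nonempty[OF map_proper[OF v']] by blast
      then have "y \<in> pverts G'" "y \<notin> insert x (\<Phi> t)"
        using sep(1) \<open>x \<notin> \<Phi> {v}\<close> tgt.proper_tube_subset[OF map_proper[OF v']] by blast+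
      then have ins: "insert x (\<Phi> t) \<in> proper_tubes G'" using x by (auto simp: tgt.proper_tubes_iff)
      define s where "s = \<Gamma> (insert x (\<Phi> t))"
      have s: "s \<in> proper_tubes G" "\<Phi> s = insert x (\<Phi> t)"
        using ins by (auto simp: s_def inv_proper map_inv)
      have "\<not> conv.straight (\<Phi> t)" using straight_conv_iff t by simp
      moreover have "insert x (\<Phi> t) \<in> tgt.outer (\<Phi> t)" using ins x by (auto simp: tgt.outer_def)
      ultimately have "s \<subset> t"
        using conv.flipped_outer[OF map_proper[OF t(1)]] inv_map[OF t(1)] by (simp add: s_def)
      then have "straight s" using False s by (auto simp: src.inner_def)
      from straight_flipped_subset(1)[OF t s(1) this] \<open>s \<subset> t\<close> s(2)
      show ?thesis using tgt.proper_tube_nonempty[OF map_proper[OF t(1)]] by auto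
    qed
  qed
qed

lemma flipped_iff_meets_body:
  assumes t: "t \<in> proper_tubes G"
  shows "\<not> straight t \<longleftrightarrow> t \<inter> body \<noteq> {}"
proof
  assume "t \<inter> body \<noteq> {}"
  then obtain v where "v \<in> t" "v \<in> pverts G" "\<not> straight {v}" by (auto simp: body_def)
  with src.singleton_proper[OF t] flipped_superset(1)[OF t, of "{v}"] show "\<not> straight t" by auto
qed (use t flipped_imp_meets_body in blast)

lemma body_clique:
  assumes "u \<in> body" "v \<in> body" "u \<noteq> v" "t \<in> proper_tubes G"
  shows "(u, v) \<in> parcs G"
proof (rule ccontr)
  assume no: "(u, v) \<notin> parcs G"
  have uv: "u \<in> pverts G" "\<not> straight {u}" "v \<in> pverts G" "\<not> straight {v}"
    using assms by (auto simp: body_def)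
  have "tube_compatible G {u} {v}" using src.singletons_compatible_iff no uv assms(3) by blast
  then show False
    using flipped_compatible_nested[of "{u}" "{v}"] src.singleton_proper[OF assms(4)] uv assms(3) by auto
qed

section \<open>Sizes of images of flipped tubes\<close>

text \<open>Vertices are removed one at a time, keeping a body vertex \<open>b\<close> so that the
  tube stays flipped. Each removal strictly enlarges the image, and at \<open>{b}\<close> the image
  is still a proper tube.\<close>

lemma flipped_card_le:
  assumes "t \<in> proper_tubes G" "\<not> straight t"
  shows "card (\<Phi> t) + card t \<le> card (pverts G')"
  using assms
proof (induction "card t" arbitrary: t rule: less_induct)
  case less
  note t = less.prems
  obtain b where b: "b \<in> t" "b \<in> body" using flipped_imp_meets_body[OF t] by blast
  have fin: "finite t" using src.finite_proper_tube[OF t(1)] .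
  show ?case
  proof (cases "t = {b}")
    case True
    have "card (\<Phi> t) < card (pverts G')"
      using tgt.proper_tube_subset[OF map_proper[OF t(1)]] tgt.finite_verts psubset_card_mono by blast
    with True show ?thesis by simp
  next
    case False
    obtain x where x: "x \<in> t" "x \<noteq> b" "t - {x} \<in> tubes G"
      using src.tube_remove_vertex[OF src.proper_tube_tube[OF t(1)] b(1) False] .
    have s: "t - {x} \<in> proper_tubes G" using src.subtube_proper[OF t(1) x(3)] by blast
    have ns: "\<not> straight (t - {x})" using flipped_iff_meets_body[OF s] b x by blast
    have c: "card t = Suc (card (t - {x}))" using x(1) fin by (metis card.remove)
    have "t \<in> src.outer (t - {x})" using t x by (auto simp: src.outer_def)
    then have "\<Phi> t \<subset> \<Phi> (t - {x})" using flipped_outer[OF s ns] by blast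
    then have "card (\<Phi> t) < card (\<Phi> (t - {x}))"
      using tgt.finite_proper_tube[OF map_proper[OF s]] psubset_card_mono by blast
    with less.hyps[OF _ s ns] c show ?thesis by simp
  qed
qed

text \<open>Dually, each added vertex strictly shrinks the image, and the image is still non-empty
  when only one vertex is missing.\<close>

lemma flipped_card_ge:
  assumes "t \<in> proper_tubes G" "\<not> straight t"
  shows "card (pverts G) \<le> card (\<Phi> t) + card t"
  using assms
proof (induction "card (pverts G) - card t" arbitrary: t rule: less_induct)
  case less
  note t = less.prems
  have fin: "finite t" using src.finite_proper_tube[OF t(1)] .
  obtain x where x: "x \<in> pverts G" "x \<notin> t" "touches G t {x}" "insert x t \<in> tubes G"
    using src.proper_tube_grow[OF t(1)] .
  show ?case
  proof (cases "insert x t = pverts G")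
    case True
    then have "card (pverts G) = Suc (card t)" using x(2) fin by (metis card_insert_disjoint)
    moreover have "card (\<Phi> t) \<noteq> 0"
      using map_proper[OF t(1)] tgt.finite_proper_tube tgt.proper_tube_nonempty by simp
    ultimately show ?thesis by simp
  next
    case False
    then have s: "insert x t \<in> proper_tubes G" using x by (simp add: src.proper_tubes_iff)
    have ns: "\<not> straight (insert x t)" using flipped_superset(1)[OF s t] by blast
    have c: "card (insert x t) = Suc (card t)" using x(2) fin by simp
    have "card (insert x t) \<le> card (pverts G)"
      using src.proper_tube_subset[OF s] src.finite_verts by (metis card_mono psubset_imp_subset)
    then have ih: "card (pverts G) \<le> card (\<Phi> (insert x t)) + card (insert x t)"
      using less.hyps[OF _ s ns] c by simp
    have "insert x t \<in> src.outer t" using s x by (auto simp: src.outer_def)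
    then have "\<Phi> (insert x t) \<subset> \<Phi> t" using flipped_outer[OF t] by blast
    then have "card (\<Phi> (insert x t)) < card (\<Phi> t)"
      using tgt.finite_proper_tube[OF map_proper[OF t(1)]] psubset_card_mono by blast
    with ih c show ?thesis by simp
  qed
qed

end

context nested_complex_iso
begin

interpretation conv: nested_complex_iso G' G \<Gamma> \<Phi>
  by (rule converse)

text \<open>The upper bound involves \<open>G'\<close> and the lower bound \<open>G\<close>. For
  \<Gamma> the roles are exchanged, so the four bounds together force equality.\<close>

lemma flipped_card:
  assumes t: "t \<in> proper_tubes G" "\<not> straight t"
  shows "card (\<Phi> t) + card t = card (pverts G)" "card (pverts G') = card (pverts G)"
proof -
  have "\<not> conv.straight (\<Phi> t)" using straight_conv_iff t by simp
  then have "card t + card (\<Phi> t) \<le> card (pverts G)" "card (pverts G') \<le> card t + card (\<Phi> t)"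
    using conv.flipped_card_le[OF map_proper[OF t(1)]] conv.flipped_card_ge[OF map_proper[OF t(1)]]
      inv_map[OF t(1)] by auto
  with flipped_card_le[OF t] flipped_card_ge[OF t]
  show "card (\<Phi> t) + card t = card (pverts G)" "card (pverts G') = card (pverts G)" by auto
qed

section \<open>The vertex map on the legs\<close>

definition leg_map :: "'a \<Rightarrow> 'b" where
  "leg_map v = the_elem (\<Phi> {v})"

text \<open>For any vertex \<open>x\<close> of \<open>\<Phi> {v}\<close>, the map \<Gamma> sends the
  subtube \<open>{x}\<close> into \<open>{v}\<close>, hence onto it.\<close>

lemma map_straight_singleton:
  assumes v: "{v} \<in> proper_tubes G" "straight {v}"
  shows "\<Phi> {v} = {leg_map v}"
proof -
  have p: "\<Phi> {v} \<in> proper_tubes G'" using map_proper[OF v(1)] .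
  then obtain x where x: "x \<in> \<Phi> {v}" using tgt.proper_tube_nonempty by blast
  then have x': "{x} \<in> proper_tubes G'" using tgt.proper_tube_subset[OF p] tgt.singleton_proper[OF p] by blast
  have "conv.straight (\<Phi> {v})" using straight_conv_iff v by simp
  from conv.straight_subset(2)[OF p this x'] x inv_map[OF v(1)] have "\<Gamma> {x} \<subseteq> {v}" by simp
  then have "\<Gamma> {x} = {v}" using src.proper_tube_nonempty[OF inv_proper[OF x']] by blast
  then have "\<Phi> {v} = {x}" using map_inv[OF x'] by simp
  then show ?thesis by (simp add: leg_map_def)
qed

end

context nested_complex_iso
begin

interpretation conv: nested_complex_iso G' G \<Gamma> \<Phi>
  by (rule converse)

context
  fixes t\<^sub>0 :: "'a set"
  assumes t\<^sub>0: "t\<^sub>0 \<in> proper_tubes G"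
begin

text \<open>The existence of any proper tube excludes the one-vertex graph, whose only singleton is
  not proper.\<close>

lemma vert_proper: "v \<in> pverts G \<Longrightarrow> {v} \<in> proper_tubes G"
  using src.singleton_proper[OF t\<^sub>0] .

lemma vert_proper': "v \<in> pverts G' \<Longrightarrow> {v} \<in> proper_tubes G'"
  using tgt.singleton_proper[OF map_proper[OF t\<^sub>0]] .

lemma map_leg: "v \<in> legs \<Longrightarrow> \<Phi> {v} = {leg_map v}"
  using map_straight_singleton vert_proper by (auto simp: legs_def)

lemma leg_map_in: "v \<in> legs \<Longrightarrow> leg_map v \<in> conv.legs"
  using map_leg[of v] straight_conv_iff[of "{v}"] vert_proper[of v] map_proper[of "{v}"]
    tgt.proper_tube_subset[of "{leg_map v}"]
  by (auto simp: legs_def conv.legs_def)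

lemma conv_leg_map: "v \<in> legs \<Longrightarrow> conv.leg_map (leg_map v) = v"
  using map_leg[of v] inv_map[of "{v}"] vert_proper[of v]
  by (auto simp: legs_def conv.leg_map_def)

end

end

context nested_complex_iso
begin

interpretation conv: nested_complex_iso G' G \<Gamma> \<Phi>
  by (rule converse)

lemma leg_map_bij:
  assumes t\<^sub>0: "t\<^sub>0 \<in> proper_tubes G"
  shows "bij_betw leg_map legs conv.legs"
proof (rule bij_betw_byWitness[where f' = conv.leg_map])
  note t\<^sub>0' = map_proper[OF t\<^sub>0]
  show "\<forall>v\<in>legs. conv.leg_map (leg_map v) = v" using conv_leg_map[OF t\<^sub>0] by blast
  show "\<forall>v\<in>conv.legs. leg_map (conv.leg_map v) = v"
    using conv.conv_leg_map[OF t\<^sub>0'] by blast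
  show "leg_map ` legs \<subseteq> conv.legs" using leg_map_in[OF t\<^sub>0] by blast
  show "conv.leg_map ` conv.legs \<subseteq> legs" using conv.leg_map_in[OF t\<^sub>0'] by blast
qed

text \<open>Adjacency of distinct vertices is incompatibility of their singletons.\<close>

lemma leg_map_arcs:
  assumes t\<^sub>0: "t\<^sub>0 \<in> proper_tubes G" and uv: "u \<in> legs" "v \<in> legs"
  shows "(leg_map u, leg_map v) \<in> parcs G' \<longleftrightarrow> (u, v) \<in> parcs G"
proof (cases "u = v")
  case True
  then show ?thesis by (simp add: src.arc_irrefl tgt.arc_irrefl)
next
  case False
  have neq: "leg_map u \<noteq> leg_map v"
    using conv_leg_map[OF t\<^sub>0] uv False by metis
  have "u \<in> pverts G" "v \<in> pverts G" "leg_map u \<in> pverts G'" "leg_map v \<in> pverts G'"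
    using uv leg_map_in[OF t\<^sub>0] by (auto simp: legs_def conv.legs_def)
  then show ?thesis
    using False neq uv src.singletons_compatible_iff tgt.singletons_compatible_iff
      compatible_iff[of "{u}" "{v}"] map_leg[OF t\<^sub>0] vert_proper[OF t\<^sub>0] by metis
qed

lemma map_straight:
  assumes t: "t \<in> proper_tubes G" "straight t"
  shows "\<Phi> t = leg_map ` t"
proof -
  have in_legs: "v \<in> legs \<and> leg_map v \<in> \<Phi> t" if "v \<in> t" for v
  proof -
    have v: "v \<in> pverts G" using that src.proper_tube_subset[OF t(1)] by blast
    have "straight {v}" "\<Phi> {v} \<subseteq> \<Phi> t"
      using straight_subset[OF t vert_proper[OF t(1) v]] that by auto
    then show ?thesis using map_leg[OF t(1), of v] v by (auto simp: legs_def)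
  qed
  moreover have "x \<in> leg_map ` t" if "x \<in> \<Phi> t" for x
  proof -
    note p = map_proper[OF t(1)]
    have x: "x \<in> pverts G'" using that tgt.proper_tube_subset[OF p] by blast
    have "conv.straight (\<Phi> t)" using straight_conv_iff t by simp
    from conv.straight_subset[OF p this vert_proper'[OF t(1) x]] that
    have "conv.straight {x}" "\<Gamma> {x} \<subseteq> t" using inv_map[OF t(1)] by auto
    then have "x \<in> conv.legs" "conv.leg_map x \<in> t"
      using x conv.map_leg[OF p, of x] by (auto simp: conv.legs_def)
    then show ?thesis using conv.conv_leg_map[OF p, of x] by (metis imageI)
  qed
  ultimately show ?thesis by blast
qed

text \<open>The position of \<open>w\<close> decides: inside \<open>t\<close>, its image is
  separated from \<open>\<Phi> t\<close>; apart from \<open>t\<close>, reversal puts the image into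
  \<open>\<Phi> t\<close>; adjacent to \<open>t\<close>, incompatibility is preserved and excludes
  membership. Neighbours of \<open>t\<close> are thus lost as well, which is what makes the later
  counting effective.\<close>

lemma leg_map_mem_flipped:
  assumes t: "t \<in> proper_tubes G" "\<not> straight t" and w: "w \<in> legs"
  shows "leg_map w \<in> \<Phi> t \<longleftrightarrow> w \<notin> t \<and> \<not> touches G t {w}"
proof -
  have w': "{w} \<in> proper_tubes G" "straight {w}" "\<Phi> {w} = {leg_map w}"
    using w vert_proper[OF t(1)] map_leg[OF t(1)] by (auto simp: legs_def)
  show ?thesis
  proof (cases "w \<in> t")
    case True
    then show ?thesis using straight_flipped_subset(1)[OF t w'(1,2)] w'(3) by auto
  next
    case out: False
    show ?thesis
    proof (cases "touches G t {w}")
      case False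
      then show ?thesis
        using straight_flipped_separate[OF t w'(1,2)] w'(3) out src.touches_sym[of t "{w}"] by auto
    next
      case True
      then have "\<not> tube_compatible G {w} t"
        using out src.singleton_incompatible(1)[OF src.proper_tube_tube[OF t(1)]]
        by (auto simp: touches_def)
      then have "\<not> tube_compatible G' (\<Phi> {w}) (\<Phi> t)" using compatible_iff w' t by blast
      then have "leg_map w \<notin> \<Phi> t" using w'(3) by (auto simp: tube_compatible_def)
      with True show ?thesis by simp
    qed
  qed
qed

lemma all_straight_imp_trivial:
  assumes all: "\<And>t. t \<in> proper_tubes G \<Longrightarrow> straight t" and t\<^sub>0: "t\<^sub>0 \<in> proper_tubes G"
  shows "trivial_isomorphism G G' \<Phi>"
proof -
  have all': "conv.straight t" if "t \<in> proper_tubes G'" for t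
    using straight_conv_iff[OF inv_proper[OF that]] all[OF inv_proper[OF that]] map_inv[OF that] by simp
  have legs: "legs = pverts G" "conv.legs = pverts G'"
    using all all' vert_proper[OF t\<^sub>0] vert_proper'[OF t\<^sub>0] by (auto simp: legs_def conv.legs_def)
  have "graph_isomorphism leg_map G G'"
    using leg_map_bij[OF t\<^sub>0] leg_map_arcs[OF t\<^sub>0] legs by (simp add: graph_isomorphism_def)
  then show ?thesis using map_straight all unfolding trivial_isomorphism_def by blast
qed

end

section \<open>The legs\<close>

lemma mem_spider_arcs:
  "((i, j), (i', j')) \<in> parcs (spider l n) \<longleftrightarrow>
    i \<in> {1..l} \<and> i' \<in> {1..l} \<and> j \<le> n i \<and> j' \<le> n i' \<and>
    (i = i' \<and> (j' = Suc j \<or> j = Suc j') \<or> i \<noteq> i' \<and> j = 0 \<and> j' = 0)"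
  by (auto simp: spider_def)

lemma spider_isomorphismI:
  assumes verts: "\<And>i j. i \<in> {1..l} \<Longrightarrow> j \<le> n i \<Longrightarrow> h i j \<in> pverts H"
    and cover: "\<And>v. v \<in> pverts H \<Longrightarrow> \<exists>i\<in>{1..l}. \<exists>j\<le>n i. v = h i j"
    and inj: "\<And>i j i' j'. i \<in> {1..l} \<Longrightarrow> i' \<in> {1..l} \<Longrightarrow> j \<le> n i \<Longrightarrow> j' \<le> n i' \<Longrightarrow>
      h i j = h i' j' \<Longrightarrow> i = i' \<and> j = j'"
    and arcs: "\<And>i j i' j'. i \<in> {1..l} \<Longrightarrow> i' \<in> {1..l} \<Longrightarrow> j \<le> n i \<Longrightarrow> j' \<le> n i' \<Longrightarrow>
      (h i j, h i' j') \<in> parcs H \<longleftrightarrow>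
      i = i' \<and> (j' = Suc j \<or> j = Suc j') \<or> i \<noteq> i' \<and> j = 0 \<and> j' = 0"
  shows "graph_isomorphism (\<lambda>(i, j). h i j) (spider l n) H"
proof -
  have S: "(i, j) \<in> pverts (spider l n) \<longleftrightarrow> i \<in> {1..l} \<and> j \<le> n i" for i j
    by (simp add: spider_def)
  have "bij_betw (\<lambda>(i, j). h i j) (pverts (spider l n)) (pverts H)"
    unfolding bij_betw_def
  proof
    show "inj_on (\<lambda>(i, j). h i j) (pverts (spider l n))"
    proof (rule inj_onI, clarify)
      fix i j i' j'
      assume "(i, j) \<in> pverts (spider l n)" "(i', j') \<in> pverts (spider l n)" "h i j = h i' j'"
      then show "i = i' \<and> j = j'" using inj[of i i' j j'] unfolding S by blast
    qed
    have "v \<in> (\<lambda>(i, j). h i j) ` pverts (spider l n)" if v: "v \<in> pverts H" for v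
    proof -
      obtain i j where "i \<in> {1..l}" "j \<le> n i" "v = h i j" using cover[OF v] by blast
      then show ?thesis using S by (intro image_eqI[of _ _ "(i, j)"]) auto
    qed
    then show "(\<lambda>(i, j). h i j) ` pverts (spider l n) = pverts H"
      using verts S by auto
  qed
  moreover have "((i, j), (i', j')) \<in> parcs (spider l n) \<longleftrightarrow> (h i j, h i' j') \<in> parcs H"
    if "(i, j) \<in> pverts (spider l n)" "(i', j') \<in> pverts (spider l n)" for i j i' j'
    using that arcs[of i i' j j'] unfolding mem_spider_arcs S by blast
  ultimately show ?thesis by (auto simp: graph_isomorphism_def)
qed

section \<open>Paths that start at the body\<close>

locale flipping_iso = nested_complex_iso +
  assumes ex_flipped: "\<exists>t\<in>proper_tubes G. \<not> straight t"
begin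

interpretation conv: nested_complex_iso G' G \<Gamma> \<Phi>
  by (rule converse)

lemma vertex_proper: "v \<in> pverts G \<Longrightarrow> {v} \<in> proper_tubes G"
  using ex_flipped vert_proper by blast

lemma card_verts_eq: "card (pverts G') = card (pverts G)"
  using ex_flipped flipped_card(2) by blast

lemma body_nonempty: "body \<noteq> {}"
  using ex_flipped flipped_imp_meets_body by blast

lemma body_arc: "u \<in> body \<Longrightarrow> v \<in> body \<Longrightarrow> u \<noteq> v \<Longrightarrow> (u, v) \<in> parcs G"
  using ex_flipped body_clique by blast

text \<open>Leg vertices in \<open>t\<close> or next to \<open>t\<close> are sent injectively
  outside \<open>\<Phi> t\<close>, where there is room for only \<open>card t\<close>
  vertices.\<close>

lemma flipped_leg_closure:
  assumes t: "t \<in> proper_tubes G" "\<not> straight t"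
    and W: "W \<subseteq> legs" "\<And>w. w \<in> W \<Longrightarrow> w \<in> t \<or> touches G t {w}"
  shows "leg_map ` W \<subseteq> pverts G' - \<Phi> t" "card (leg_map ` W) = card W"
    "card (pverts G' - \<Phi> t) = card t" "card W \<le> card t"
proof -
  show sub: "leg_map ` W \<subseteq> pverts G' - \<Phi> t"
    using W leg_map_mem_flipped[OF t] leg_map_in[OF t(1)] by (auto simp: conv.legs_def)
  show inj: "card (leg_map ` W) = card W"
    using leg_map_bij[OF t(1)] W(1) by (intro card_image) (auto simp: bij_betw_def intro: inj_on_subset)
  have "\<Phi> t \<subseteq> pverts G'" "finite (\<Phi> t)"
    using tgt.proper_tube_subset tgt.finite_proper_tube map_proper[OF t(1)] by blast+
  then show c: "card (pverts G' - \<Phi> t) = card t"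
    using flipped_card[OF t] by (simp add: card_Diff_subset)
  show "card W \<le> card t"
    using card_mono[OF _ sub] tgt.finite_verts inj c by simp
qed

text \<open>\<open>m\<close> counts the vertices outside the body, so \<open>m = 0\<close> is a bare
  body vertex. The equivalence for arcs excludes chords.\<close>

definition leg_path_spec :: "nat \<Rightarrow> (nat \<Rightarrow> 'a) \<Rightarrow> bool" where
  "leg_path_spec m f \<longleftrightarrow> f 0 \<in> body \<and> inj_on f {..m} \<and> f ` {1..m} \<subseteq> legs \<and>
    (\<forall>i\<le>m. \<forall>j\<le>m. (f i, f j) \<in> parcs G \<longleftrightarrow> j = Suc i \<or> i = Suc j)"

lemma initial_segment_tube:
  assumes f: "leg_path_spec m f" and "k \<le> m"
  shows "f ` {..k} \<in> tubes G"
  using \<open>k \<le> m\<close>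
proof (induction k)
  case 0
  then show ?case using f by (auto simp: leg_path_spec_def body_def intro: src.singleton_tube)
next
  case (Suc k)
  then have "insert (f (Suc k)) (f ` {..k}) \<in> tubes G"
    using f by (intro src.tube_insert[of _ "f k"]) (auto simp: leg_path_spec_def)
  then show ?case by (simp add: atMost_Suc)
qed

lemma initial_segment_flipped:
  assumes f: "leg_path_spec m f" and k: "k \<le> m" and "f ` {..k} \<noteq> pverts G"
  shows "f ` {..k} \<in> proper_tubes G" "\<not> straight (f ` {..k})"
proof -
  show p: "f ` {..k} \<in> proper_tubes G"
    using initial_segment_tube[OF f k] assms by (simp add: src.proper_tubes_iff)
  have "f 0 \<in> f ` {..k} \<inter> body" using f by (auto simp: leg_path_spec_def)
  then show "\<not> straight (f ` {..k})" using flipped_iff_meets_body[OF p] by blast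
qed

text \<open>By the cardinality bound, a flipped tube with a single body vertex has at most one
  neighbouring leg vertex outside, so the leg of a body vertex grows one vertex at a time.\<close>

lemma ex_leg:
  assumes b: "b \<in> body"
  obtains m f where "f 0 = b" "leg_path_spec m f"
    "\<And>w. w \<in> legs \<Longrightarrow> touches G (f ` {..m}) {w} \<Longrightarrow> w \<in> f ` {..m}"
proof -
  \<comment> \<open>Only the vertices before the last one must have all their leg neighbours on the
    path; the last may still have one outside, by which the path is prolonged. Injectivity bounds
    the length, so a longest path exists.\<close>
  define Q where "Q k f \<longleftrightarrow> f 0 = b \<and> leg_path_spec k f \<and>
    (\<forall>i<k. \<forall>w\<in>legs. (f i, w) \<in> parcs G \<longrightarrow> w \<in> f ` {..k})" for k f
  have "Q 0 (\<lambda>_. b)" using b by (auto simp: Q_def leg_path_spec_def src.arc_irrefl)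
  moreover have "k \<le> card (pverts G)" if "Q k f" for k f
  proof -
    have "f ` {..k} \<subseteq> pverts G"
      using that initial_segment_tube[of k f k] src.tube_subset by (auto simp: Q_def)
    then have "card {..k} \<le> card (pverts G)"
      using that src.finite_verts by (intro card_inj_on_le) (auto simp: Q_def leg_path_spec_def)
    then show ?thesis by simp
  qed
  ultimately have "\<exists>m. (\<exists>f. Q m f) \<and> (\<forall>k. (\<exists>f. Q k f) \<longrightarrow> k \<le> m)"
    by (intro ex_has_greatest_nat[of "\<lambda>k. \<exists>f. Q k f" 0 "\<lambda>k. k" "Suc (card (pverts G))"])
      (auto simp: less_Suc_eq_le)
  then obtain m f where Q: "Q m f" and max: "\<And>k g. Q k g \<Longrightarrow> k \<le> m" by blast
  then have f: "f 0 = b" "leg_path_spec m f"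
    and prefix: "\<And>i w. i < m \<Longrightarrow> w \<in> legs \<Longrightarrow> (f i, w) \<in> parcs G \<Longrightarrow> w \<in> f ` {..m}"
    unfolding Q_def by blast+
  have "w \<in> f ` {..m}" if w: "w \<in> legs" "touches G (f ` {..m}) {w}" for w
  proof (rule ccontr)
    assume new: "w \<notin> f ` {..m}"
    have only: "i = m" if "i \<le> m" "(f i, w) \<in> parcs G" for i
      using prefix[of i w] that w new by fastforce
    with w have last: "(f m, w) \<in> parcs G" by (auto simp: touches_def)
    have ne: "f ` {..m} \<noteq> pverts G" using new w by (auto simp: legs_def)
    note T = initial_segment_flipped[OF f(2) order_refl ne]
    have leg: "f ` {1..m} \<subseteq> legs" and inj: "inj_on f {..m}"
      and arcs: "\<And>i j. i \<le> m \<Longrightarrow> j \<le> m \<Longrightarrow> (f i, f j) \<in> parcs G \<longleftrightarrow> j = Suc i \<or> i = Suc j"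
      using f(2) by (auto simp: leg_path_spec_def)
    have uniq: "v = w" if v: "v \<in> legs" "(f m, v) \<in> parcs G" "v \<notin> f ` {..m}" for v
    proof (rule ccontr)
      assume "v \<noteq> w"
      have "finite (f ` {1..m})" "v \<notin> f ` {1..m}" "w \<notin> f ` {1..m}" using new v by auto
      then have "card (insert v (insert w (f ` {1..m}))) = Suc (Suc (card (f ` {1..m})))"
        using \<open>v \<noteq> w\<close> by simp
      moreover have "card (f ` {1..m}) = m" "card (f ` {..m}) = Suc m"
        using inj card_image[of f "{1..m}"] card_image[of f "{..m}"] inj_on_subset[OF inj, of "{1..m}"]
        by auto
      \<comment> \<open>The path is a flipped tube with m + 1 vertices; its m leg vertices together
        with \<open>v\<close> and \<open>w\<close> are m + 2 leg vertices in it or next to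
        it.\<close>
      moreover have "card (insert v (insert w (f ` {1..m}))) \<le> card (f ` {..m})"
        using v w leg last by (intro flipped_leg_closure(4)[OF T]) (auto simp: touches_def)
      ultimately show False by simp
    qed
    define g where "g = f(Suc m := w)"
    have g: "g i = f i" if "i \<le> m" for i using that by (simp add: g_def)
    have img: "g ` {..Suc m} = insert w (f ` {..m})"
      by (auto simp: g_def atMost_Suc)
    have "leg_path_spec (Suc m) g"
      unfolding leg_path_spec_def
    proof (intro conjI allI impI)
      show "g 0 \<in> body" using f b by (simp add: g_def)
      show "inj_on g {..Suc m}"
        using inj new by (auto simp: inj_on_def g_def le_Suc_eq)
      show "g ` {1..Suc m} \<subseteq> legs"
        using leg w by (auto simp: g_def le_Suc_eq)
      have new_arc: "(f i, w) \<in> parcs G \<longleftrightarrow> i = m" if "i \<le> m" for i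
        using only[OF that] last by blast
      then have new_arc': "(w, f i) \<in> parcs G \<longleftrightarrow> i = m" if "i \<le> m" for i
        using that src.arc_sym by blast
      fix i j assume ij: "i \<le> Suc m" "j \<le> Suc m"
      consider "i \<le> m" "j \<le> m" | "i \<le> m" "j = Suc m" | "i = Suc m" "j \<le> m" | "i = Suc m" "j = Suc m"
        using ij by linarith
      then show "(g i, g j) \<in> parcs G \<longleftrightarrow> j = Suc i \<or> i = Suc j"
      proof cases
        case 1
        then show ?thesis using arcs by (simp add: g)
      next
        case 2
        then show ?thesis using new_arc[of i] by (auto simp: g_def)
      next
        case 3
        then show ?thesis using new_arc'[of j] by (auto simp: g_def)
      next
        case 4
        then show ?thesis using src.arc_irrefl by simp
      qed
    qed
    \<comment> \<open>The former last vertex now satisfies the condition too: by \<open>uniq\<close>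
      its only leg neighbour off the old path is \<open>w\<close>.\<close>
    moreover have "v \<in> g ` {..Suc m}" if "i < Suc m" "v \<in> legs" "(g i, v) \<in> parcs G" for i v
      using prefix[of i v] uniq[of v] that g[of i] unfolding img by (cases "i = m") auto
    ultimately have "Q (Suc m) g" using f b by (auto simp: Q_def g_def)
    with max[of "Suc m" g] show False by simp
  qed
  with f show thesis by (rule that)
qed

end

section \<open>Spider coordinates on the source graph\<close>

text \<open>\<open>f i j\<close> is to play the role of the spider vertex \<open>(i, j)\<close>.
  Each leg is closed under passing to adjacent leg vertices; that different legs are disjoint and
  joined only at their roots is derived below.\<close>

locale labelled_flipping_iso = flipping_iso +
  fixes l :: nat and n :: "nat \<Rightarrow> nat" and f :: "nat \<Rightarrow> nat \<Rightarrow> 'a"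
  assumes body_bij: "bij_betw (\<lambda>i. f i 0) {1..l} body"
    and leg: "i \<in> {1..l} \<Longrightarrow> leg_path_spec (n i) (f i)"
    and leg_closed: "i \<in> {1..l} \<Longrightarrow> w \<in> legs \<Longrightarrow> touches G (f i ` {..n i}) {w} \<Longrightarrow> w \<in> f i ` {..n i}"
begin

interpretation conv: nested_complex_iso G' G \<Gamma> \<Phi>
  by (rule converse)

lemma root_in_body: "i \<in> {1..l} \<Longrightarrow> f i 0 \<in> body"
  using body_bij by (auto simp: bij_betw_def)

lemma root_inj: "i \<in> {1..l} \<Longrightarrow> i' \<in> {1..l} \<Longrightarrow> f i 0 = f i' 0 \<Longrightarrow> i = i'"
  using inj_onD[OF bij_betw_imp_inj_on[OF body_bij]] by blast

lemma in_legs: "i \<in> {1..l} \<Longrightarrow> 1 \<le> j \<Longrightarrow> j \<le> n i \<Longrightarrow> f i j \<in> legs"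
  using leg[of i] by (auto simp: leg_path_spec_def)

lemma in_body_iff: "i \<in> {1..l} \<Longrightarrow> j \<le> n i \<Longrightarrow> f i j \<in> body \<longleftrightarrow> j = 0"
  using root_in_body[of i] in_legs[of i j] body_Int_legs by (cases "j = 0") auto

lemma in_verts: "i \<in> {1..l} \<Longrightarrow> j \<le> n i \<Longrightarrow> f i j \<in> pverts G"
  using root_in_body[of i] in_legs[of i j] by (cases "j = 0") (auto simp: body_def legs_def)

lemma leg_inj: "i \<in> {1..l} \<Longrightarrow> j \<le> n i \<Longrightarrow> j' \<le> n i \<Longrightarrow> f i j = f i j' \<longleftrightarrow> j = j'"
  using leg[of i] by (auto simp: leg_path_spec_def inj_on_def)

lemma leg_step:
  assumes "i \<in> {1..l}" "j \<le> n i" "w \<in> legs" "(f i j, w) \<in> parcs G"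
  shows "w \<in> f i ` {1..n i}"
proof -
  have "touches G (f i ` {..n i}) {w}" using assms by (auto simp: touches_def)
  then obtain k where k: "k \<le> n i" "w = f i k" using leg_closed[OF assms(1,3)] by blast
  moreover have "w \<noteq> f i 0" using root_in_body[OF assms(1)] assms(3) body_Int_legs by blast
  ultimately have "k \<in> {1..n i}" by (cases "k = 0") auto
  with k show ?thesis by blast
qed

lemma leg_tube:
  assumes i: "i \<in> {1..l}" and "1 \<le> n i"
  shows "f i ` {1..n i} \<in> tubes G"
proof -
  have "f i ` {1..k} \<in> tubes G" if "1 \<le> k" "k \<le> n i" for k
    using that
  proof (induction k rule: dec_induct)
    case base
    then show ?case using in_verts[OF i, of 1] by (simp add: src.singleton_tube)
  next
    case (step k)
    then have "insert (f i (Suc k)) (f i ` {1..k}) \<in> tubes G"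
      using leg[OF i] by (intro src.tube_insert[of _ "f i k"]) (auto simp: leg_path_spec_def)
    then show ?case using step by (simp add: atLeastAtMostSuc_conv)
  qed
  then show ?thesis using assms by blast
qed

text \<open>Otherwise an arc within the first leg would leave the common part, although the second
  leg is closed under arcs to leg vertices.\<close>

lemma leg_subset_leg:
  assumes i: "i \<in> {1..l}" and i': "i' \<in> {1..l}"
    and meet: "f i ` {1..n i} \<inter> f i' ` {1..n i'} \<noteq> {}"
  shows "f i ` {1..n i} \<subseteq> f i' ` {1..n i'}"
proof (rule ccontr)
  define C where "C = f i ` {1..n i}"
  define D where "D = f i' ` {1..n i'}"
  assume "\<not> ?thesis"
  then have "C \<inter> D \<subset> C" by (auto simp: C_def D_def)
  moreover have "C \<in> tubes G" unfolding C_def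
    using meet by (intro leg_tube[OF i]) (cases "n i", auto)
  moreover have "C \<inter> D \<noteq> {}" using meet by (simp add: C_def D_def)
  ultimately obtain u v where uv: "u \<in> C \<inter> D" "v \<in> C" "v \<notin> C \<inter> D" "(u, v) \<in> parcs G"
    using src.tube_cut_obtain[of C "C \<inter> D"] by metis
  then obtain j where "j \<le> n i'" "u = f i' j" by (auto simp: D_def)
  moreover have "v \<in> legs" using uv(2) in_legs[OF i] by (auto simp: C_def)
  ultimately have "v \<in> D" using leg_step[OF i'] uv(4) by (simp add: D_def)
  with uv show False by blast
qed

text \<open>If a path were attached to the body at both ends, by \<open>b\<close> and \<open>c\<close>, then the tube consisting
  of \<open>b\<close> and all but the last vertex of the path and its analogue for \<open>c\<close> would both be mapped to the
  complement of the image of the path.\<close>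

lemma legs_disjoint:
  assumes i: "i \<in> {1..l}" and i': "i' \<in> {1..l}"
    and meet: "f i ` {1..n i} \<inter> f i' ` {1..n i'} \<noteq> {}"
  shows "i = i'"
proof -
  define C where "C = f i ` {1..n i}"
  have C': "C = f i' ` {1..n i'}"
    using leg_subset_leg[OF i i'] leg_subset_leg[OF i' i] meet unfolding C_def by blast
  have seg: "f k ` {..n k - 1} \<in> proper_tubes G \<and> \<Phi> (f k ` {..n k - 1}) = pverts G' - leg_map ` C"
    if k: "k \<in> {1..l}" and C: "C = f k ` {1..n k}" for k
  proof -
    have pos: "1 \<le> n k" using meet C C_def by (cases "n k") auto
    have "f k (n k) \<notin> f k ` {..n k - 1}"
    proof
      assume "f k (n k) \<in> f k ` {..n k - 1}"
      then obtain j where "j \<le> n k - 1" "f k (n k) = f k j" by auto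
      then have "j < n k" using pos by simp
      with leg_inj[OF k order_refl, of j] \<open>f k (n k) = f k j\<close> show False by simp
    qed
    then have "f k ` {..n k - 1} \<noteq> pverts G" using in_verts[OF k, of "n k"] by auto
    note T = initial_segment_flipped[OF leg[OF k] _ this]
    have "w \<in> f k ` {..n k - 1} \<or> touches G (f k ` {..n k - 1}) {w}" if w: "w \<in> C" for w
    proof -
      obtain j where j: "1 \<le> j" "j \<le> n k" "w = f k j" using w C by auto
      then have "(f k (j - 1), w) \<in> parcs G" using leg[OF k] by (auto simp: leg_path_spec_def)
      moreover have "f k (j - 1) \<in> f k ` {..n k - 1}" using j by auto
      ultimately show ?thesis by (auto simp: touches_def)
    qed
    note cl = flipped_leg_closure[OF T _ this]
    have "C \<subseteq> legs" using in_legs[OF k] C by auto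
    moreover have "card C = n k" "card (f k ` {..n k - 1}) = n k"
      using leg_inj[OF k] pos unfolding C by (subst card_image; auto simp: inj_on_def)+
    \<comment> \<open>An inclusion between sets of equal size: compared with \<open>C\<close>, the
      tube drops the last vertex of the path but gains the root, so it has as many vertices as
      \<open>C\<close>.\<close>
    ultimately have "leg_map ` C = pverts G' - \<Phi> (f k ` {..n k - 1})"
      using cl tgt.finite_verts by (intro card_subset_eq) auto
    moreover have "\<Phi> (f k ` {..n k - 1}) \<subseteq> pverts G'"
      using T tgt.proper_tube_subset map_proper by (simp add: psubset_imp_subset)
    ultimately show ?thesis using T by auto
  qed
  \<comment> \<open>The two tubes have the same image, so they coincide; each contains only one body
    vertex, hence the roots agree.\<close>
  have eq: "f i ` {..n i - 1} = f i' ` {..n i' - 1}"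
    using seg[OF i C_def, THEN conjunct1, THEN inv_map] seg[OF i' C', THEN conjunct1, THEN inv_map]
      seg[OF i C_def, THEN conjunct2] seg[OF i' C', THEN conjunct2] by simp
  have "f i 0 \<in> f i ` {..n i - 1}" by blast
  then have "f i 0 \<in> f i' ` {..n i' - 1}" unfolding eq .
  then obtain j where "j \<le> n i' - 1" "f i 0 = f i' j" by blast
  then have j: "j \<le> n i'" "f i 0 = f i' j" by simp_all
  then have "j = 0" using in_body_iff[OF i' j(1)] root_in_body[OF i] by simp
  with j have "f i 0 = f i' 0" by simp
  then show ?thesis using root_inj i i' by blast
qed

lemma coordinates_inj:
  assumes "i \<in> {1..l}" "i' \<in> {1..l}" "j \<le> n i" "j' \<le> n i'" "f i j = f i' j'"
  shows "i = i' \<and> j = j'"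
proof -
  have "i = i'"
  proof (cases "j = 0 \<or> j' = 0")
    case True
    moreover have "j = 0 \<longleftrightarrow> f i j \<in> body" "j' = 0 \<longleftrightarrow> f i' j' \<in> body"
      using in_body_iff[OF assms(1,3)] in_body_iff[OF assms(2,4)] by simp_all
    ultimately have "j = 0 \<and> j' = 0" using assms(5) by simp
    then show ?thesis using root_inj[OF assms(1,2)] assms(5) by simp
  next
    case False
    then have "j \<in> {1..n i}" "j' \<in> {1..n i'}" using assms by auto
    then have "f i j \<in> f i ` {1..n i} \<inter> f i' ` {1..n i'}" unfolding assms(5) using assms(5) by (metis IntI imageI)
    then show ?thesis by (intro legs_disjoint assms) auto
  qed
  then show ?thesis using assms leg_inj[of i j j'] by simp
qed

lemma coordinates_arc:
  assumes i: "i \<in> {1..l}" "i' \<in> {1..l}" "j \<le> n i" "j' \<le> n i'"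
  shows "(f i j, f i' j') \<in> parcs G \<longleftrightarrow>
    i = i' \<and> (j' = Suc j \<or> j = Suc j') \<or> i \<noteq> i' \<and> j = 0 \<and> j' = 0"
proof (cases "i = i'")
  case True
  then show ?thesis using i leg[of i] by (auto simp: leg_path_spec_def)
next
  case neq: False
  show ?thesis
  proof (cases "j = 0 \<and> j' = 0")
    case True
    then show ?thesis using i neq root_in_body body_arc coordinates_inj[of i i' 0 0] by auto
  next
    case False
    \<comment> \<open>By \<open>leg_step\<close>, an arc to a leg vertex ends on the leg on which it
      starts. The other direction of the arc follows by symmetry.\<close>
    have cross: "(f a x, f c y) \<notin> parcs G"
      if "a \<in> {1..l}" "c \<in> {1..l}" "x \<le> n a" "y \<le> n c" "1 \<le> y" "a \<noteq> c" for a c x y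
    proof
      assume "(f a x, f c y) \<in> parcs G"
      then have "f c y \<in> f a ` {1..n a}" using that in_legs by (intro leg_step[of a x]) auto
      then obtain z where "z \<le> n a" "f c y = f a z" by auto
      then show False using coordinates_inj[of c a y z] that by simp
    qed
    have "(f i j, f i' j') \<notin> parcs G"
      using False cross[of i i' j j'] cross[of i' i j' j] i neq src.arc_sym by fastforce
    then show ?thesis using False neq by simp
  qed
qed

text \<open>The union of the paths contains the body, so an arc leaving it would end in a leg
  vertex, which \<open>leg_step\<close> puts back on a path.\<close>

lemma coordinates_cover:
  assumes v: "v \<in> pverts G"
  obtains i j where "i \<in> {1..l}" "j \<le> n i" "v = f i j"
proof -
  define U where "U = (\<Union>i\<in>{1..l}. f i ` {..n i})"
  have bU: "body \<subseteq> U"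
  proof
    fix v assume "v \<in> body"
    then obtain i where "i \<in> {1..l}" "v = f i 0"
      using bij_betw_imp_surj_on[OF body_bij] by blast
    then show "v \<in> U" unfolding U_def by blast
  qed
  have "U = pverts G"
  proof (rule ccontr)
    assume "U \<noteq> pverts G"
    then have "U \<subset> pverts G" using in_verts by (auto simp: U_def)
    moreover have "U \<noteq> {}" using bU body_nonempty by blast
    ultimately obtain u w where uw: "u \<in> U" "w \<in> pverts G" "w \<notin> U" "(u, w) \<in> parcs G"
      using src.tube_cut_obtain[OF src.verts_tube] by blast
    then obtain i j where ij: "i \<in> {1..l}" "j \<le> n i" "u = f i j" by (auto simp: U_def)
    have "w \<in> legs" using uw bU body_Un_legs by blast
    then have "w \<in> f i ` {1..n i}" using leg_step[OF ij(1,2)] uw(4) ij(3) by blast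
    then obtain k where "k \<le> n i" "w = f i k" by auto
    then have "w \<in> U" using ij(1) by (auto simp: U_def)
    with uw(3) show False by blast
  qed
  then have "v \<in> (\<Union>i\<in>{1..l}. f i ` {..n i})" using v by (simp add: U_def)
  then show thesis using that by blast
qed

lemma legs_cover:
  assumes w: "w \<in> legs"
  obtains i j where "i \<in> {1..l}" "1 \<le> j" "j \<le> n i" "w = f i j"
proof -
  obtain i j where ij: "i \<in> {1..l}" "j \<le> n i" "w = f i j"
    using coordinates_cover[of w] w by (auto simp: legs_def)
  moreover have "j \<noteq> 0" using w ij in_body_iff[of i j] body_Int_legs by auto
  ultimately show thesis by (intro that) auto
qed

lemma spider_iso: "graph_isomorphism (\<lambda>(i, j). f i j) (spider l n) G"
proof (rule spider_isomorphismI)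
  show "\<exists>i\<in>{1..l}. \<exists>j\<le>n i. v = f i j" if "v \<in> pverts G" for v
    by (rule coordinates_cover[OF that]) blast
qed (fact in_verts coordinates_inj coordinates_arc)+

text \<open>The part of \<open>t\<close> beyond a missing vertex of a leg could be joined to the
  body vertices of \<open>t\<close> only through that missing vertex.\<close>

lemma root_side_closed:
  assumes t: "t \<in> tubes G" "t \<inter> body \<noteq> {}" and i: "i \<in> {1..l}" and j: "j \<le> n i" "f i j \<in> t"
    and "j' \<le> j"
  shows "f i j' \<in> t"
  using \<open>j' \<le> j\<close>
proof (induction rule: inc_induct)
  case base
  then show ?case using j by simp
next
  case (step k)
  show ?case
  proof (rule ccontr)
    assume out: "f i k \<notin> t"
    define s where "s = t \<inter> f i ` {Suc k..n i}"
    have "f i (Suc k) \<in> s" using step j by (auto simp: s_def)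
    moreover have "s \<subseteq> legs" using in_legs[OF i] by (auto simp: s_def)
    then have "s \<noteq> t" using t(2) body_Int_legs by blast
    then have "s \<subset> t" by (auto simp: s_def)
    ultimately obtain u v where uv: "u \<in> s" "v \<in> t" "v \<notin> s" "(u, v) \<in> parcs G"
      using src.tube_cut_obtain[OF t(1), of s] by blast
    obtain a where a: "Suc k \<le> a" "a \<le> n i" "u = f i a" using uv(1) by (auto simp: s_def)
    have "v \<in> pverts G" using uv(4) src.arc_verts by blast
    then obtain i' b where b: "i' \<in> {1..l}" "b \<le> n i'" "v = f i' b" by (rule coordinates_cover)
    have "i = i' \<and> (b = Suc a \<or> a = Suc b)"
      using coordinates_arc[of i i' a b] uv(4) a b i by auto
    moreover from this have "\<not> Suc k \<le> b" using uv(2,3) b by (auto simp: s_def)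
    ultimately have "i' = i" "b = k" using a(1) by auto
    then have "v = f i k" using b(3) by simp
    with out uv show False by simp
  qed
qed

lemma card_body: "card body = l"
  using bij_betw_same_card[OF body_bij] by simp

section \<open>The body of the target graph\<close>

text \<open>By \<open>flipped_card\<close>, the image of such a tube is a singleton; the body
  vertices of \<open>G'\<close> are obtained in this way. If \<open>n i = 0\<close>, the end of the
  leg is its root.\<close>

definition end_complement :: "nat \<Rightarrow> 'a set" where
  "end_complement i = pverts G - {f i (n i)}"

text \<open>Removing an end disconnects nothing: each remaining vertex still reaches its root along
  its leg, and the remaining roots form a clique. Some root remains, since otherwise
  \<open>G\<close> would be a single vertex.\<close>

lemma end_complement_flipped:
  assumes i: "i \<in> {1..l}"
  shows "end_complement i \<in> proper_tubes G" "\<not> straight (end_complement i)"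
proof -
  have last: "f i (n i) \<in> pverts G" using in_verts i by simp
  have root: "\<exists>i'\<in>{1..l}. f i' 0 \<in> end_complement i"
  proof (rule ccontr)
    assume none: "\<not> ?thesis"
    have "f i' j = f i (n i)" if "i' \<in> {1..l}" "j \<le> n i'" for i' j
    proof -
      have all: "f k 0 = f i (n i)" if "k \<in> {1..l}" for k
        using none that in_verts[of k 0] by (auto simp: end_complement_def)
      have "n i = 0" using all[OF i] leg_inj[OF i, of 0 "n i"] by simp
      moreover have "i' = i" using all[OF \<open>i' \<in> {1..l}\<close>] all[OF i] root_inj i \<open>i' \<in> {1..l}\<close> by metis
      ultimately show ?thesis using that by simp
    qed
    then have "pverts G \<subseteq> {f i (n i)}"
      using coordinates_cover by (metis singletonI subsetI)
    then have "{f i (n i)} = pverts G" using last by blast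
    then show False using vertex_proper[OF last] src.proper_tube_subset by blast
  qed
  have "end_complement i \<in> tubes G"
  proof (rule src.tubeI)
    show "end_complement i \<noteq> {}" using root by blast
    fix s assume s: "s \<subset> end_complement i" "s \<noteq> {}"
    show "touches G s (end_complement i - s)"
    proof (rule ccontr)
      assume sep: "\<not> ?thesis"
      have same: "u \<in> s \<longleftrightarrow> v \<in> s"
        if "u \<in> end_complement i" "v \<in> end_complement i" "(u, v) \<in> parcs G" for u v
        using sep that src.arc_sym by (auto simp: touches_def)
      have to_root: "f i' 0 \<in> end_complement i \<and> (f i' j \<in> s \<longleftrightarrow> f i' 0 \<in> s)"
        if i': "i' \<in> {1..l}" and j: "j \<le> n i'" "f i' j \<in> end_complement i" for i' j
        using j
      proof (induction j)
        case (Suc j)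
        have "f i' j \<noteq> f i (n i)" using coordinates_inj[of i' i j "n i"] i i' Suc.prems by auto
        then have e: "f i' j \<in> end_complement i"
          using in_verts[OF i', of j] Suc.prems by (simp add: end_complement_def)
        moreover have "(f i' j, f i' (Suc j)) \<in> parcs G"
          using coordinates_arc[of i' i' j "Suc j"] i' Suc.prems by simp
        ultimately show ?case using Suc same by simp
      qed simp
      obtain x y where xy: "x \<in> s" "x \<in> end_complement i" "y \<in> end_complement i" "y \<notin> s" using s by blast
      obtain a j where a: "a \<in> {1..l}" "j \<le> n a" "x = f a j"
        using coordinates_cover[of x] xy by (auto simp: end_complement_def)
      obtain c k where c: "c \<in> {1..l}" "k \<le> n c" "y = f c k"
        using coordinates_cover[of y] xy by (auto simp: end_complement_def)
      have "f a 0 \<in> end_complement i" "f a 0 \<in> s" "f c 0 \<in> end_complement i" "f c 0 \<notin> s"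
        using to_root[OF a(1,2)] to_root[OF c(1,2)] a c xy by auto
      moreover from this have "(f a 0, f c 0) \<in> parcs G"
        using body_arc root_in_body a c by metis
      ultimately show False using same by blast
    qed
  qed (auto simp: end_complement_def)
  then show p: "end_complement i \<in> proper_tubes G"
    using last by (auto simp: src.proper_tubes_iff end_complement_def)
  show "\<not> straight (end_complement i)"
    using flipped_iff_meets_body[OF p] root root_in_body by blast
qed

definition body_map :: "nat \<Rightarrow> 'b" where
  "body_map i = the_elem (\<Phi> (end_complement i))"

lemma map_end_complement:
  assumes i: "i \<in> {1..l}"
  shows "\<Phi> (end_complement i) = {body_map i}"
proof -
  note T = end_complement_flipped[OF i]
  have "card (end_complement i) = card (pverts G) - 1"
    using in_verts[OF i, of "n i"] src.finite_verts by (simp add: end_complement_def)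
  moreover have "card (pverts G) \<noteq> 0" using in_verts[OF i, of "n i"] src.finite_verts by auto
  ultimately have "card (\<Phi> (end_complement i)) = 1" using flipped_card(1)[OF T] by simp
  then obtain x where "\<Phi> (end_complement i) = {x}" by (rule card_1_singletonE)
  then show ?thesis by (simp add: body_map_def)
qed

lemma body_map_in_body:
  assumes i: "i \<in> {1..l}"
  shows "body_map i \<in> conv.body"
proof -
  note T = end_complement_flipped[OF i]
  have "\<not> conv.straight {body_map i}" "body_map i \<in> pverts G'"
    using T straight_conv_iff[OF T(1)] tgt.proper_tube_subset[OF map_proper[OF T(1)]]
    unfolding map_end_complement[OF i] by blast+
  then show ?thesis by (simp add: conv.body_def)
qed

text \<open>Since \<open>{body_map i}\<close> is the image of \<open>end_complement i\<close>,
  reversal of inclusion turns membership into \<open>t \<subseteq> end_complement i\<close>.\<close>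

lemma body_map_mem_flipped:
  assumes t: "t \<in> proper_tubes G" "\<not> straight t" and i: "i \<in> {1..l}"
  shows "body_map i \<in> \<Phi> t \<longleftrightarrow> f i (n i) \<notin> t"
proof -
  have "\<Phi> (end_complement i) \<subseteq> \<Phi> t \<longleftrightarrow> t \<subseteq> end_complement i"
    using flipped_subset_iff[OF t end_complement_flipped[OF i]] .
  then show ?thesis
    using map_end_complement[OF i] src.proper_tube_subset[OF t(1)] by (auto simp: end_complement_def)
qed

lemma body_map_inj:
  assumes "i \<in> {1..l}" "i' \<in> {1..l}" "body_map i = body_map i'"
  shows "i = i'"
proof -
  have "\<Phi> (end_complement i) = \<Phi> (end_complement i')"
    using assms map_end_complement by simp
  then have "end_complement i = end_complement i'"
    using assms end_complement_flipped(1) inv_map by metis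
  then have "f i (n i) = f i' (n i')"
    using in_verts[OF assms(1), of "n i"] in_verts[OF assms(2), of "n i'"] by (auto simp: end_complement_def)
  then show ?thesis using coordinates_inj assms by blast
qed

lemma leg_map_bij_legs: "bij_betw leg_map legs conv.legs"
  using leg_map_bij ex_flipped by blast

lemma leg_map_eq_iff: "u \<in> legs \<Longrightarrow> v \<in> legs \<Longrightarrow> leg_map u = leg_map v \<longleftrightarrow> u = v"
  using inj_on_eq_iff[OF bij_betw_imp_inj_on[OF leg_map_bij_legs]] .

lemma leg_map_in_legs: "v \<in> legs \<Longrightarrow> leg_map v \<in> conv.legs"
  using bij_betwE[OF leg_map_bij_legs] by blast

text \<open>By counting: the graphs have equally many vertices and, through \<open>leg_map\<close>,
  equally many leg vertices, hence bodies of equal size.\<close>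

lemma body_map_surj: "body_map ` {1..l} = conv.body"
proof (rule card_subset_eq)
  have fin: "finite conv.body" "finite conv.legs" "finite body" "finite legs"
    using tgt.finite_verts src.finite_verts conv.body_Un_legs body_Un_legs by (metis finite_Un)+
  then show "finite conv.body" by simp
  show "body_map ` {1..l} \<subseteq> conv.body" using body_map_in_body by blast
  have "card conv.body + card conv.legs = card body + card legs"
    using card_verts_eq fin conv.body_Un_legs body_Un_legs conv.body_Int_legs body_Int_legs
      card_Un_disjoint[of conv.body conv.legs] card_Un_disjoint[of body legs] by simp
  then have "card conv.body = l" using bij_betw_same_card[OF leg_map_bij_legs] card_body by simp
  moreover have "inj_on body_map {1..l}" using body_map_inj by (auto intro: inj_onI)
  ultimately show "card (body_map ` {1..l}) = card conv.body" by (simp add: card_image)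
qed

text \<open>Every leg is traversed backwards on the side of \<open>G'\<close>.\<close>

definition image_coord :: "nat \<Rightarrow> nat \<Rightarrow> 'b" where
  "image_coord i j = (if j = 0 then body_map i else leg_map (f i (Suc (n i) - j)))"

section \<open>Spider coordinates on the target graph\<close>

text \<open>Pulled back along \<Phi>, the singletons become \<open>end_complement i\<close> and
  \<open>{w}\<close>. These are nested, hence compatible, unless \<open>w\<close> is the missing
  end, when they are disjoint with union \<open>pverts G\<close>, a tube.\<close>

lemma body_leg_arc:
  assumes i: "i \<in> {1..l}" and w: "w \<in> legs"
  shows "(body_map i, leg_map w) \<in> parcs G' \<longleftrightarrow> w = f i (n i)"
proof -
  note T = end_complement_flipped[OF i]
  have w': "w \<in> pverts G" using w by (auto simp: legs_def)
  have v: "body_map i \<in> pverts G'" "leg_map w \<in> pverts G'" "body_map i \<noteq> leg_map w"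
    using body_map_in_body[OF i] leg_map_in_legs[OF w] conv.body_Int_legs
    by (auto simp: conv.body_def conv.legs_def)
  have "(body_map i, leg_map w) \<notin> parcs G' \<longleftrightarrow> tube_compatible G' {body_map i} {leg_map w}"
    using tgt.singletons_compatible_iff[OF v] by simp
  also have "\<dots> \<longleftrightarrow> tube_compatible G (end_complement i) {w}"
    using compatible_iff[OF T(1) vertex_proper[OF w']] map_end_complement[OF i] map_leg[OF T(1) w] by simp
  also have "\<dots> \<longleftrightarrow> w \<noteq> f i (n i)"
  proof (cases "w = f i (n i)")
    case True
    then have "end_complement i \<union> {w} = pverts G" "end_complement i \<inter> {w} = {}"
      using w' by (auto simp: end_complement_def)
    moreover have "end_complement i \<noteq> {}" using src.proper_tube_nonempty[OF T(1)] .
    ultimately show ?thesis using True src.verts_tube by (auto simp: tube_compatible_def)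
  next
    case False
    then show ?thesis using w' by (auto simp: tube_compatible_def end_complement_def)
  qed
  finally show ?thesis by blast
qed

lemma image_coord_arc:
  assumes i: "i \<in> {1..l}" "i' \<in> {1..l}" "j \<le> n i" "j' \<le> n i'"
  shows "(image_coord i j, image_coord i' j') \<in> parcs G' \<longleftrightarrow>
    i = i' \<and> (j' = Suc j \<or> j = Suc j') \<or> i \<noteq> i' \<and> j = 0 \<and> j' = 0"
proof -
  \<comment> \<open>\<open>k = 1\<close> is the first position after the root on an image leg; it
    carries the image of the far end \<open>f c (n c)\<close>.\<close>
  have mixed: "(body_map a, leg_map (f c (Suc (n c) - k))) \<in> parcs G' \<longleftrightarrow> a = c \<and> k = 1"
    if "a \<in> {1..l}" "c \<in> {1..l}" "1 \<le> k" "k \<le> n c" for a c k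
  proof -
    have "(body_map a, leg_map (f c (Suc (n c) - k))) \<in> parcs G' \<longleftrightarrow> f c (Suc (n c) - k) = f a (n a)"
      using that in_legs[of c "Suc (n c) - k"] by (intro body_leg_arc) auto
    also have "\<dots> \<longleftrightarrow> c = a \<and> Suc (n c) - k = n a"
    proof
      assume "f c (Suc (n c) - k) = f a (n a)"
      then show "c = a \<and> Suc (n c) - k = n a" using that by (intro coordinates_inj) auto
    qed (elim conjE, simp only:)
    also have "\<dots> \<longleftrightarrow> a = c \<and> k = 1" using that by auto
    finally show ?thesis .
  qed
  consider "j = 0" "j' = 0" | "j = 0" "1 \<le> j'" | "1 \<le> j" "j' = 0" | "1 \<le> j" "1 \<le> j'" by linarith
  then show ?thesis
  proof cases
    case 1
    have "(body_map i, body_map i') \<in> parcs G' \<longleftrightarrow> i \<noteq> i'"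
      using body_map_inj[OF i(1,2)] body_map_in_body i tgt.arc_irrefl
        conv.body_clique[of "body_map i" "body_map i'"] ex_flipped map_proper by metis
    with 1 show ?thesis by (auto simp: image_coord_def)
  next
    case 2
    then show ?thesis using mixed[OF i(1,2) _ i(4)] by (auto simp: image_coord_def)
  next
    case 3
    have "(image_coord i j, image_coord i' j') \<in> parcs G' \<longleftrightarrow> (image_coord i' j', image_coord i j) \<in> parcs G'"
      using tgt.arc_sym by blast
    with 3 show ?thesis using mixed[OF i(2,1) _ i(3)] by (auto simp: image_coord_def)
  next
    case 4
    have "f i (Suc (n i) - j) \<in> legs" "f i' (Suc (n i') - j') \<in> legs"
      using 4 i by (auto intro!: in_legs)
    moreover obtain t where "t \<in> proper_tubes G" using ex_flipped by blast
    ultimately have "(image_coord i j, image_coord i' j') \<in> parcs G' \<longleftrightarrow>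
        (f i (Suc (n i) - j), f i' (Suc (n i') - j')) \<in> parcs G"
      using leg_map_arcs 4 by (simp add: image_coord_def)
    also have "\<dots> \<longleftrightarrow> i = i' \<and> (Suc (n i') - j' = Suc (Suc (n i) - j) \<or> Suc (n i) - j = Suc (Suc (n i') - j'))"
      using 4 i by (subst coordinates_arc) auto
    also have "\<dots> \<longleftrightarrow> i = i' \<and> (j' = Suc j \<or> j = Suc j')"
      using 4 i by auto
    finally show ?thesis using 4 by auto
  qed
qed

lemma image_coord_inj:
  assumes i: "i \<in> {1..l}" "i' \<in> {1..l}" "j \<le> n i" "j' \<le> n i'" and eq: "image_coord i j = image_coord i' j'"
  shows "i = i' \<and> j = j'"
proof -
  have zero: "image_coord a k \<in> conv.body \<longleftrightarrow> k = 0" if "a \<in> {1..l}" "k \<le> n a" for a k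
  proof (cases "k = 0")
    case False
    then have "f a (Suc (n a) - k) \<in> legs" using that by (auto intro!: in_legs)
    then have "image_coord a k \<in> conv.legs" using leg_map_in_legs False by (simp add: image_coord_def)
    with False show ?thesis using conv.body_Int_legs by blast
  qed (use body_map_in_body that in \<open>simp add: image_coord_def\<close>)
  have z: "j = 0 \<longleftrightarrow> j' = 0" using zero[of i j] zero[of i' j'] i eq by simp
  show ?thesis
  proof (cases "j = 0")
    case True
    with z eq body_map_inj[OF i(1,2)] show ?thesis by (simp add: image_coord_def)
  next
    case False
    have "f i (Suc (n i) - j) \<in> legs" "f i' (Suc (n i') - j') \<in> legs"
      using False z i by (auto intro!: in_legs)
    then have "f i (Suc (n i) - j) = f i' (Suc (n i') - j')"
      using eq False z leg_map_eq_iff by (simp add: image_coord_def)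
    then have "i = i' \<and> Suc (n i) - j = Suc (n i') - j'"
      using False z i by (intro coordinates_inj) auto
    with i False z show ?thesis by auto
  qed
qed

lemma image_coord_in_verts:
  assumes i: "i \<in> {1..l}" "j \<le> n i"
  shows "image_coord i j \<in> pverts G'"
proof (cases "j = 0")
  case True
  then show ?thesis using body_map_in_body[OF i(1)] by (simp add: image_coord_def conv.body_def)
next
  case False
  then have "f i (Suc (n i) - j) \<in> legs" using i by (auto intro!: in_legs)
  then have "image_coord i j \<in> conv.legs" using leg_map_in_legs False by (simp add: image_coord_def)
  then show ?thesis by (simp add: conv.legs_def)
qed

lemma image_coord_cover:
  assumes v: "v \<in> pverts G'"
  obtains i j where "i \<in> {1..l}" "j \<le> n i" "v = image_coord i j"
proof (cases "v \<in> conv.body")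
  case True
  then obtain i where "i \<in> {1..l}" "v = body_map i" using body_map_surj by blast
  then show thesis by (intro that[of i 0]) (simp_all add: image_coord_def)
next
  case False
  then have "v \<in> conv.legs" using v conv.body_Un_legs by blast
  then obtain w where w: "w \<in> legs" "v = leg_map w"
    using bij_betw_imp_surj_on[OF leg_map_bij_legs] by blast
  obtain i j where ij: "i \<in> {1..l}" "1 \<le> j" "j \<le> n i" "w = f i j" using legs_cover[OF w(1)] .
  then show thesis using w by (intro that[of i "Suc (n i) - j"]) (auto simp: image_coord_def)
qed

end

section \<open>Tubes in coordinates and the map \<Omega>\<close>

lemma down_closed_eq_lessThan_card:
  fixes D :: "nat set"
  assumes "finite D" "\<And>i j. j \<in> D \<Longrightarrow> i \<le> j \<Longrightarrow> i \<in> D"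
  shows "D = {..<card D}"
proof (cases "D = {}")
  case False
  have "D = {..Max D}"
  proof
    show "D \<subseteq> {..Max D}" using Max_ge[OF assms(1)] by auto
    show "{..Max D} \<subseteq> D" using assms(2)[OF Max_in[OF assms(1) False]] by auto
  qed
  then have "D = {..<Suc (Max D)}" by (simp only: lessThan_Suc_atMost)
  then show ?thesis by (metis card_lessThan)
qed simp

lemma leg_path_of_nat: "leg_path i (int a) (int c) = Pair i ` {a..c}"
  by (auto simp: leg_path_def)

context labelled_flipping_iso
begin

lemma image_spider_iso: "graph_isomorphism (\<lambda>(i, j). image_coord i j) (spider l n) G'"
proof (rule spider_isomorphismI)
  show "\<exists>i\<in>{1..l}. \<exists>j\<le>n i. v = image_coord i j" if "v \<in> pverts G'" for v
    by (rule image_coord_cover[OF that]) blast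
qed (fact image_coord_in_verts image_coord_inj image_coord_arc)+

text \<open>A straight tube avoids the body and cannot leave its leg by \<open>leg_step\<close>; a
  gap in its indices would give a cut that no arc crosses.\<close>

lemma straight_tube_interval:
  assumes t: "t \<in> proper_tubes G" "straight t"
  obtains i a c where "i \<in> {1..l}" "1 \<le> a" "a \<le> c" "c \<le> n i" "t = f i ` {a..c}"
proof -
  have tt: "t \<in> tubes G" using t by (simp add: src.proper_tube_tube)
  have tl: "t \<subseteq> legs"
    using t flipped_iff_meets_body[OF t(1)] src.proper_tube_subset[OF t(1)] body_Un_legs by blast
  obtain w where "w \<in> t" using src.tube_nonempty[OF tt] by blast
  then obtain i j\<^sub>0 where i: "i \<in> {1..l}" and j\<^sub>0: "1 \<le> j\<^sub>0" "j\<^sub>0 \<le> n i" "f i j\<^sub>0 \<in> t"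
    using tl legs_cover by (metis subsetD)
  define J where "J = {j \<in> {1..n i}. f i j \<in> t}"
  have J: "finite J" "j\<^sub>0 \<in> J" "J \<subseteq> {1..n i}" using j\<^sub>0 by (auto simp: J_def)
  have "t \<inter> f i ` {1..n i} = t"
  proof (rule ccontr)
    assume "t \<inter> f i ` {1..n i} \<noteq> t"
    then have "t \<inter> f i ` {1..n i} \<subset> t" by blast
    moreover have "t \<inter> f i ` {1..n i} \<noteq> {}" using j\<^sub>0 by auto
    ultimately obtain u v where uv: "u \<in> t \<inter> f i ` {1..n i}" "v \<in> t" "v \<notin> t \<inter> f i ` {1..n i}"
        "(u, v) \<in> parcs G"
      using src.tube_cut_obtain[OF tt, of "t \<inter> f i ` {1..n i}"] by metis
    then obtain k where "k \<le> n i" "u = f i k" by auto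
    then have "v \<in> f i ` {1..n i}" using leg_step[OF i] uv tl by blast
    with uv show False by blast
  qed
  then have "t \<subseteq> f i ` {1..n i}" by blast
  then have tJ: "t = f i ` J" unfolding J_def by blast
  have "x \<in> J" if x: "x \<in> {Min J..Max J}" for x
  proof (rule ccontr)
    assume "x \<notin> J"
    define s where "s = f i ` {j \<in> J. j < x}"
    have mm: "Min J \<in> J" "Max J \<in> J" using Min_in[OF J(1)] Max_in[OF J(1)] J(2) by auto
    with x \<open>x \<notin> J\<close> have lt: "Min J < x" "x < Max J" by (metis atLeastAtMost_iff le_neq_implies_less)+
    have "f i (Min J) \<in> s" using mm lt by (auto simp: s_def)
    have "f i (Max J) \<notin> s"
    proof
      assume "f i (Max J) \<in> s"
      then obtain j where j: "j \<in> J" "j < x" "f i (Max J) = f i j" by (auto simp: s_def)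
      have "Max J \<le> n i" "j \<le> n i" using subsetD[OF J(3)] mm(2) j(1) by auto
      then have "Max J = j" using leg_inj[OF i, of "Max J" j] j(3) by simp
      with j lt show False by simp
    qed
    then have "s \<subset> t" using mm unfolding tJ s_def by blast
    then obtain u v where uv: "u \<in> s" "v \<in> t" "v \<notin> s" "(u, v) \<in> parcs G"
      using src.tube_cut_obtain[OF tt, of s] \<open>f i (Min J) \<in> s\<close> by blast
    obtain j where j: "j \<in> J" "j < x" "u = f i j" using uv(1) by (auto simp: s_def)
    obtain k where k: "k \<in> J" "v = f i k" using uv(2) tJ by auto
    have "\<not> k < x" using k uv(3) by (auto simp: s_def)
    moreover have "k = Suc j \<or> j = Suc k"
    proof -
      have "j \<le> n i" "k \<le> n i" using subsetD[OF J(3)] j(1) k(1) by auto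
      then show ?thesis using coordinates_arc[OF i i] uv(4) unfolding j(3) k(2) by simp
    qed
    moreover have "k \<noteq> x" using k \<open>x \<notin> J\<close> by blast
    ultimately show False using j(2) by linarith
  qed
  then have "{Min J..Max J} \<subseteq> J" by blast
  moreover have "J \<subseteq> {Min J..Max J}" using J(1) by auto
  ultimately have eq: "t = f i ` {Min J..Max J}" unfolding tJ by blast
  have mm: "Min J \<in> J" "Max J \<in> J" using Min_in[OF J(1)] Max_in[OF J(1)] J(2) by auto
  then have "1 \<le> Min J" "Max J \<le> n i" using subsetD[OF J(3)] by auto
  moreover have "Min J \<le> Max J" using Min_le[OF J(1) mm(2)] .
  ultimately show thesis using that[OF i _ _ _ eq] by blast
qed

text \<open>If \<open>t\<close> occupies leg \<open>i\<close> up to position \<open>k\<close>, then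
  \<open>\<Phi> t\<close> occupies it up to \<open>n i - 1 - k\<close>, as \<Omega> prescribes for
  body tubes. Roots come from \<open>body_map\<close> and other positions from
  \<open>leg_map\<close>, yet both obey one formula.\<close>

lemma map_flipped_coordinates:
  assumes t: "t \<in> proper_tubes G" "\<not> straight t" and i: "i \<in> {1..l}" and j: "j \<le> n i"
  shows "image_coord i j \<in> \<Phi> t \<longleftrightarrow> f i (n i - j) \<notin> t"
proof (cases "j = 0")
  case True
  then show ?thesis using body_map_mem_flipped[OF t i] by (simp add: image_coord_def)
next
  case False
  define a where "a = Suc (n i) - j"
  have a: "1 \<le> a" "a \<le> n i" "n i - j = a - 1" using False j by (auto simp: a_def)
  have closed: "f i j' \<in> t" if "k \<le> n i" "f i k \<in> t" "j' \<le> k" for j' k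
    using root_side_closed[OF src.proper_tube_tube[OF t(1)] flipped_imp_meets_body[OF t] i] that by blast
  \<comment> \<open>\<open>t\<close> occupies an initial segment of the leg, and all neighbours of
    \<open>f i a\<close> are on that leg because \<open>a\<close> is positive. The resulting shift
    to \<open>a - 1\<close> matters: without it the image would reach one position further.\<close>
  have "f i a \<in> t \<or> touches G t {f i a} \<longleftrightarrow> f i (a - 1) \<in> t"
  proof
    assume "f i a \<in> t \<or> touches G t {f i a}"
    then show "f i (a - 1) \<in> t"
    proof
      assume "touches G t {f i a}"
      then obtain u where u: "u \<in> t" "(u, f i a) \<in> parcs G" by (auto simp: touches_def)
      obtain i' b where b: "i' \<in> {1..l}" "b \<le> n i'" "u = f i' b"
        using coordinates_cover[of u] u src.arc_verts by metis
      have "i' = i \<and> (a = Suc b \<or> b = Suc a)"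
        using coordinates_arc[of i' i b a] b i a u by auto
      then show ?thesis using closed[of b "a - 1"] u b a by auto
    qed (use closed[of a "a - 1"] a in simp)
  next
    assume "f i (a - 1) \<in> t"
    moreover have "(f i (a - 1), f i a) \<in> parcs G"
      using coordinates_arc[of i i "a - 1" a] i a by auto
    ultimately show "f i a \<in> t \<or> touches G t {f i a}" by (auto simp: touches_def)
  qed
  moreover have "image_coord i j = leg_map (f i a)" using False by (simp add: image_coord_def a_def)
  moreover have "leg_map (f i a) \<in> \<Phi> t \<longleftrightarrow> \<not> (f i a \<in> t \<or> touches G t {f i a})"
    using leg_map_mem_flipped[OF t in_legs[OF i a(1,2)]] by simp
  ultimately show ?thesis by (simp only: a(3))
qed

text \<open>Read with \<open>f\<close> on the source and \<open>image_coord\<close> on the target,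
  \<Phi> is \<Omega> itself: straight tubes fall under its leg rule, flipped ones under its body
  rule.\<close>

lemma map_eq_omega:
  assumes t: "t \<in> proper_tubes G"
  obtains s where "s \<subseteq> pverts (spider l n)" "spider_omega l n s \<subseteq> pverts (spider l n)"
    "t = (\<lambda>(i, j). f i j) ` s" "\<Phi> t = (\<lambda>(i, j). image_coord i j) ` spider_omega l n s"
proof (cases "straight t")
  case True
  obtain i a c where i: "i \<in> {1..l}" and ac: "1 \<le> a" "a \<le> c" "c \<le> n i" and t_eq: "t = f i ` {a..c}"
    using straight_tube_interval[OF t True] .
  define s where "s = leg_path i (int a) (int c)"
  have "spider_omega l n s = leg_path i (int (n i) + 1 - int c) (int (n i) + 1 - int a)"
    unfolding s_def using i ac by (intro spider_omega_leg) auto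
  also have "\<dots> = leg_path i (int (Suc (n i) - c)) (int (Suc (n i) - a))"
    using ac by (simp add: of_nat_diff algebra_simps)
  finally have omega: "spider_omega l n s = Pair i ` {Suc (n i) - c..Suc (n i) - a}"
    by (simp add: leg_path_of_nat)
  have "\<Phi> t = leg_map ` f i ` {a..c}" using map_straight[OF t True] t_eq by simp
  also have "\<dots> = image_coord i ` {Suc (n i) - c..Suc (n i) - a}"
  proof -
    have "{Suc (n i) - c..Suc (n i) - a} = (\<lambda>j. Suc (n i) - j) ` {a..c}"
    proof -
      have "x \<in> (\<lambda>j. Suc (n i) - j) ` {a..c}" if "x \<in> {Suc (n i) - c..Suc (n i) - a}" for x
        using that ac by (intro image_eqI[of _ _ "Suc (n i) - x"]) auto
      then show ?thesis using ac by auto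
    qed
    moreover have "image_coord i (Suc (n i) - j) = leg_map (f i j)" if "j \<in> {a..c}" for j
      using that ac by (auto simp: image_coord_def)
    ultimately show ?thesis by (simp add: image_image)
  qed
  finally have "\<Phi> t = (\<lambda>(i, j). image_coord i j) ` spider_omega l n s"
    by (simp add: omega image_image)
  moreover have "t = (\<lambda>(i, j). f i j) ` s"
    by (simp add: s_def t_eq leg_path_of_nat image_image)
  moreover have "s \<subseteq> pverts (spider l n)"
    using i ac by (auto simp: s_def leg_path_of_nat spider_def)
  moreover have "spider_omega l n s \<subseteq> pverts (spider l n)"
    using i ac by (auto simp: omega spider_def)
  ultimately show thesis using that by blast
next
  case False
  define D where "D i = {j. j \<le> n i \<and> f i j \<in> t}" for i
  \<comment> \<open>The last occupied position, one less than the number of occupied positions from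
    0 on; it is -1 if \<open>t\<close> misses the leg, matching the empty path.\<close>
  define k where "k i = int (card (D i)) - 1" for i
  have D: "D i = {..<card (D i)}" if i: "i \<in> {1..l}" for i
  proof (rule down_closed_eq_lessThan_card)
    show "finite (D i)" by (auto simp: D_def)
    show "a \<in> D i" if "b \<in> D i" "a \<le> b" for a b
      using root_side_closed[OF src.proper_tube_tube[OF t] flipped_imp_meets_body[OF t False] i, of b a] that
      by (auto simp: D_def)
  qed
  have mem: "f i j \<in> t \<longleftrightarrow> int j \<le> k i" if "i \<in> {1..l}" "j \<le> n i" for i j
  proof -
    have "f i j \<in> t \<longleftrightarrow> j \<in> {..<card (D i)}" using D[OF that(1)] that(2) by (auto simp: D_def)
    then show ?thesis by (auto simp: k_def)
  qed
  have k: "-1 \<le> k i \<and> k i \<le> int (n i)" for i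
  proof -
    have "card (D i) \<le> card {..n i}" by (intro card_mono) (auto simp: D_def)
    then show ?thesis by (simp add: k_def)
  qed
  define s where "s = (\<Union>i\<in>{1..l}. leg_path i 0 (k i))"
  have omega: "spider_omega l n s = (\<Union>i\<in>{1..l}. leg_path i 0 (int (n i) - 1 - k i))"
    unfolding s_def using k by (intro spider_omega_body) simp
  have s: "(i, j) \<in> s \<longleftrightarrow> i \<in> {1..l} \<and> int j \<le> k i" for i j
    by (auto simp: s_def mem_leg_path)
  have om: "(i, j) \<in> spider_omega l n s \<longleftrightarrow> i \<in> {1..l} \<and> int j \<le> int (n i) - 1 - k i" for i j
    unfolding omega by (auto simp: mem_leg_path)
  have sub: "s \<subseteq> pverts (spider l n)" "spider_omega l n s \<subseteq> pverts (spider l n)"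
  proof -
    have "(i, j) \<in> pverts (spider l n)" if "(i, j) \<in> s \<or> (i, j) \<in> spider_omega l n s" for i j
      using that k[of i] unfolding s om by (auto simp: spider_def)
    then show "s \<subseteq> pverts (spider l n)" "spider_omega l n s \<subseteq> pverts (spider l n)" by auto
  qed
  have "t = (\<lambda>(i, j). f i j) ` s"
  proof
    show "t \<subseteq> (\<lambda>(i, j). f i j) ` s"
    proof
      fix v assume v: "v \<in> t"
      then obtain i j where "i \<in> {1..l}" "j \<le> n i" "v = f i j"
        using coordinates_cover src.proper_tube_subset[OF t] by blast
      then show "v \<in> (\<lambda>(i, j). f i j) ` s"
        using v mem s by (intro image_eqI[of _ _ "(i, j)"]) auto
    qed
    show "(\<lambda>(i, j). f i j) ` s \<subseteq> t"
    proof clarify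
      fix i j assume "(i, j) \<in> s"
      then show "f i j \<in> t" using mem[of i j] s[of i j] k[of i] by auto
    qed
  qed
  moreover have "\<Phi> t = (\<lambda>(i, j). image_coord i j) ` spider_omega l n s"
  proof
    have key: "image_coord i j \<in> \<Phi> t \<longleftrightarrow> (i, j) \<in> spider_omega l n s" if "i \<in> {1..l}" "j \<le> n i" for i j
      using map_flipped_coordinates[OF t False that] mem[OF that(1), of "n i - j"] that om[of i j]
      by (auto simp: of_nat_diff)
    show "\<Phi> t \<subseteq> (\<lambda>(i, j). image_coord i j) ` spider_omega l n s"
    proof
      fix v assume v: "v \<in> \<Phi> t"
      then obtain i j where "i \<in> {1..l}" "j \<le> n i" "v = image_coord i j"
        using image_coord_cover tgt.proper_tube_subset[OF map_proper[OF t]] by blast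
      then show "v \<in> (\<lambda>(i, j). image_coord i j) ` spider_omega l n s"
        using v key by (intro image_eqI[of _ _ "(i, j)"]) auto
    qed
    show "(\<lambda>(i, j). image_coord i j) ` spider_omega l n s \<subseteq> \<Phi> t"
    proof clarify
      fix i j assume "(i, j) \<in> spider_omega l n s"
      then show "image_coord i j \<in> \<Phi> t" using key[of i j] om[of i j] k[of i] by auto
    qed
  qed
  ultimately show thesis using that sub by blast
qed

end

lemma (in flipping_iso) ex_labelling: "\<exists>l n f. labelled_flipping_iso G G' \<Phi> \<Gamma> l n f"
proof -
  have "finite body" using src.finite_verts body_Un_legs by (metis finite_Un)
  then obtain e where e: "bij_betw e {1..card body} body"
    using ex_bij_betw_nat_finite_1 by blast
  have "\<exists>p. snd p 0 = e i \<and> leg_path_spec (fst p) (snd p) \<and>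
      (\<forall>w\<in>legs. touches G (snd p ` {..fst p}) {w} \<longrightarrow> w \<in> snd p ` {..fst p})"
    if i: "i \<in> {1..card body}" for i
  proof -
    have "e i \<in> body" using bij_betwE[OF e] i by blast
    then obtain m f where "f 0 = e i" "leg_path_spec m f"
        "\<And>w. w \<in> legs \<Longrightarrow> touches G (f ` {..m}) {w} \<Longrightarrow> w \<in> f ` {..m}"
      by (rule ex_leg) blast
    then show ?thesis by (intro exI[of _ "(m, f)"]) simp
  qed
  then obtain p where p: "\<And>i. i \<in> {1..card body} \<Longrightarrow> snd (p i) 0 = e i \<and>
      leg_path_spec (fst (p i)) (snd (p i)) \<and>
      (\<forall>w\<in>legs. touches G (snd (p i) ` {..fst (p i)}) {w} \<longrightarrow> w \<in> snd (p i) ` {..fst (p i)})"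
    by metis
  have "bij_betw (\<lambda>i. snd (p i) 0) {1..card body} body"
    using e p by (subst bij_betw_cong[of _ _ e]) auto
  then have "labelled_flipping_iso G G' \<Phi> \<Gamma> (card body) (\<lambda>i. fst (p i)) (\<lambda>i. snd (p i))"
    using p by unfold_locales blast+
  then show ?thesis by blast
qed


section \<open>Isomorphisms induced by graph isomorphisms\<close>

lemma graph_isomorphism_inv:
  assumes "graph_isomorphism \<phi> G H"
  shows "graph_isomorphism (inv_into (pverts G) \<phi>) H G"
proof -
  have b: "bij_betw \<phi> (pverts G) (pverts H)"
    and arcs: "\<And>u v. u \<in> pverts G \<Longrightarrow> v \<in> pverts G \<Longrightarrow> (u, v) \<in> parcs G \<longleftrightarrow> (\<phi> u, \<phi> v) \<in> parcs H"
    using assms by (auto simp: graph_isomorphism_def)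
  let ?\<psi> = "inv_into (pverts G) \<phi>"
  have "?\<psi> x \<in> pverts G" "\<phi> (?\<psi> x) = x" if "x \<in> pverts H" for x
    using that b bij_betwE[OF bij_betw_inv_into[OF b]] bij_betw_inv_into_right[OF b] by blast+
  then have "(u, v) \<in> parcs H \<longleftrightarrow> (?\<psi> u, ?\<psi> v) \<in> parcs G" if "u \<in> pverts H" "v \<in> pverts H" for u v
    using that arcs[of "?\<psi> u" "?\<psi> v"] by simp
  then show ?thesis using bij_betw_inv_into[OF b] by (simp add: graph_isomorphism_def)
qed

lemma graph_isomorphism_comp:
  assumes "graph_isomorphism \<phi> G H" "graph_isomorphism \<psi> H K"
  shows "graph_isomorphism (\<psi> \<circ> \<phi>) G K"
  using assms bij_betw_trans[of \<phi> "pverts G" "pverts H" \<psi> "pverts K"] bij_betwE[of \<phi> "pverts G" "pverts H"]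
  by (simp add: graph_isomorphism_def)

lemma graph_isomorphism_image_tube:
  assumes iso: "graph_isomorphism \<phi> G H" and "pair_graph G" "pair_graph H" and t: "t \<in> tubes G"
  shows "\<phi> ` t \<in> tubes H"
proof -
  note G = tubes_iff_cuts[OF \<open>pair_graph G\<close>] and H = tubes_iff_cuts[OF \<open>pair_graph H\<close>]
  have tV: "t \<subseteq> pverts G" "t \<noteq> {}" using t by (auto simp: tubes_def)
  have img: "\<phi> ` pverts G = pverts H" using iso by (auto simp: graph_isomorphism_def bij_betw_def)
  have "touches H s (\<phi> ` t - s)" if s: "s \<subset> \<phi> ` t" "s \<noteq> {}" for s
  proof -
    define r where "r = {x \<in> t. \<phi> x \<in> s}"
    have "r \<subset> t" "r \<noteq> {}" using s by (auto simp: r_def)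
    then have "touches G r (t - r)" using t G by blast
    then obtain u v where uv: "u \<in> r" "v \<in> t" "v \<notin> r" "(u, v) \<in> parcs G" by (auto simp: touches_def)
    have "u \<in> pverts G" "v \<in> pverts G" using uv tV by (auto simp: r_def)
    then have "(\<phi> u, \<phi> v) \<in> parcs H" using iso uv(4) by (auto simp: graph_isomorphism_def)
    moreover have "\<phi> u \<in> s" "\<phi> v \<in> \<phi> ` t - s" using uv by (auto simp: r_def)
    ultimately show ?thesis unfolding touches_def by blast
  qed
  then show ?thesis using tV img unfolding H by auto
qed

lemma graph_isomorphism_image_tube_iff:
  assumes iso: "graph_isomorphism \<phi> G H" and "pair_graph G" "pair_graph H" and t: "t \<subseteq> pverts G"
  shows "\<phi> ` t \<in> tubes H \<longleftrightarrow> t \<in> tubes G"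
proof
  assume "\<phi> ` t \<in> tubes H"
  then have "inv_into (pverts G) \<phi> ` \<phi> ` t \<in> tubes G"
    using graph_isomorphism_image_tube[OF graph_isomorphism_inv[OF iso]] assms by blast
  moreover have "inv_into (pverts G) \<phi> ` \<phi> ` t = t"
    using iso t by (intro inv_into_image_cancel) (auto simp: graph_isomorphism_def bij_betw_def)
  ultimately show "t \<in> tubes G" by simp
qed (use graph_isomorphism_image_tube assms in blast)

lemma graph_isomorphism_nested_complex_isomorphism:
  assumes iso: "graph_isomorphism \<phi> G H" and "connected_graph G" "connected_graph H"
  shows "nested_complex_isomorphism G H (\<lambda>t. \<phi> ` t)"
proof -
  interpret G: connected_graph G by fact
  interpret H: connected_graph H by fact
  have inj: "inj_on \<phi> (pverts G)" and img: "\<phi> ` pverts G = pverts H"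
    using iso by (auto simp: graph_isomorphism_def bij_betw_def)
  note tube_iff = graph_isomorphism_image_tube_iff[OF iso G.pair_graph H.pair_graph]
  have sub: "t \<subseteq> pverts G" if "t \<in> proper_tubes G" for t
    using G.proper_tube_subset[OF that] by blast
  have image_eq: "\<phi> ` s = \<phi> ` t \<longleftrightarrow> s = t" if "s \<subseteq> pverts G" "t \<subseteq> pverts G" for s t
    using inj that by (rule inj_on_image_eq_iff)
  have subset_iff: "\<phi> ` s \<subseteq> \<phi> ` t \<longleftrightarrow> s \<subseteq> t" if "s \<subseteq> pverts G" "t \<subseteq> pverts G" for s t
    using image_eq[OF Un_least[OF that] that(2)] by (simp only: subset_Un_eq image_Un)
  have proper_iff: "\<phi> ` t \<in> proper_tubes H \<longleftrightarrow> t \<in> proper_tubes G" if "t \<subseteq> pverts G" for t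
    using tube_iff[OF that] image_eq[OF that order_refl] img
    by (simp add: G.proper_tubes_iff H.proper_tubes_iff)
  have "bij_betw (\<lambda>t. \<phi> ` t) (proper_tubes G) (proper_tubes H)"
    unfolding bij_betw_def
  proof
    show "inj_on (\<lambda>t. \<phi> ` t) (proper_tubes G)" using image_eq sub by (auto intro: inj_onI)
    have "t' \<in> (\<lambda>t. \<phi> ` t) ` proper_tubes G" if t': "t' \<in> proper_tubes H" for t'
    proof -
      have "t' \<subseteq> \<phi> ` pverts G" using H.proper_tube_subset[OF t'] img by blast
      then obtain t where "t \<subseteq> pverts G" "t' = \<phi> ` t" by (auto simp: subset_image_iff)
      then show ?thesis using t' proper_iff by blast
    qed
    moreover have "\<phi> ` t \<in> proper_tubes H" if "t \<in> proper_tubes G" for t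
      using proper_iff[OF sub[OF that]] that by simp
    ultimately show "(\<lambda>t. \<phi> ` t) ` proper_tubes G = proper_tubes H" by auto
  qed
  moreover have "tube_compatible G s t \<longleftrightarrow> tube_compatible H (\<phi> ` s) (\<phi> ` t)"
    if st: "s \<in> proper_tubes G" "t \<in> proper_tubes G" for s t
  proof -
    have "\<phi> ` s \<union> \<phi> ` t \<in> tubes H \<longleftrightarrow> s \<union> t \<in> tubes G"
      using tube_iff[of "s \<union> t"] sub[OF st(1)] sub[OF st(2)] by (simp add: image_Un)
    moreover have "\<phi> ` s \<inter> \<phi> ` t = {} \<longleftrightarrow> s \<inter> t = {}"
      using inj_on_image_Int[OF inj sub[OF st(1)] sub[OF st(2)]] by (metis image_is_empty)
    moreover have "\<phi> ` s \<subseteq> \<phi> ` t \<longleftrightarrow> s \<subseteq> t" "\<phi> ` t \<subseteq> \<phi> ` s \<longleftrightarrow> t \<subseteq> s"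
      using subset_iff[OF sub sub] st by simp_all
    ultimately show ?thesis by (simp add: tube_compatible_def)
  qed
  ultimately show ?thesis by (simp add: nested_complex_isomorphism_def)
qed

text \<open>Without proper tubes both graphs have a single vertex, and the only map between these is
  a graph isomorphism.\<close>

lemma no_proper_tubes_imp_trivial:
  assumes "connected_graph G" "connected_graph G'" "nested_complex_isomorphism G G' \<Phi>"
    and empty: "proper_tubes G = {}"
  shows "trivial_isomorphism G G' \<Phi>"
proof -
  interpret G: connected_graph G by fact
  interpret G': connected_graph G' by fact
  have empty': "proper_tubes G' = {}"
    using assms(3) empty by (auto simp: nested_complex_isomorphism_def bij_betw_def)
  obtain v where v: "v \<in> pverts G" using G.tube_nonempty[OF G.verts_tube] by blast
  obtain v' where v': "v' \<in> pverts G'" using G'.tube_nonempty[OF G'.verts_tube] by blast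
  have "pverts G = {v}"
    using G.singleton_tube[OF v] G.proper_tubes_iff[of "{v}"] empty by simp
  moreover have "pverts G' = {v'}"
    using G'.singleton_tube[OF v'] G'.proper_tubes_iff[of "{v'}"] empty' by simp
  ultimately have "graph_isomorphism (\<lambda>_. v') G G'"
    using G.arc_irrefl G'.arc_irrefl by (simp add: graph_isomorphism_def)
  then show ?thesis using empty by (auto simp: trivial_isomorphism_def)
qed

theorem theorem5p7:
  fixes G :: "'a pair_pre_digraph" and G' :: "'b pair_pre_digraph"
    and \<Phi> :: "'a set \<Rightarrow> 'b set"
  assumes "pair_graph G" and "pair_graph G'"
    and "connected (with_proj G)" and "connected (with_proj G')"
    and "nested_complex_isomorphism G G' \<Phi>"
    and "\<not> trivial_isomorphism G G' \<Phi>"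
  shows "is_spider G \<and> is_spider G' \<and>
    (\<exists>l n \<theta> \<psi> \<Psi>.
       graph_isomorphism \<theta> (spider l n) G \<and>
       nested_complex_isomorphism G G (omega_via l n \<theta>) \<and>
       \<not> trivial_isomorphism G G (omega_via l n \<theta>) \<and>
       graph_isomorphism \<psi> G G' \<and>
       \<Psi> = (\<lambda>t. \<psi> ` t) \<and>
       nested_complex_isomorphism G G' \<Psi> \<and>
       (\<forall>t\<in>proper_tubes G. (inv_into (proper_tubes G) \<Psi> \<circ> \<Phi>) t = omega_via l n \<theta> t))"
proof -
  have cG: "connected_graph G" and cG': "connected_graph G'"
    using assms by (simp_all add: connected_graph_def)
  interpret G: connected_graph G by (rule cG)
  interpret G': connected_graph G' by (rule cG')
  have b: "bij_betw \<Phi> (proper_tubes G) (proper_tubes G')"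
    and comp: "\<And>s t. s \<in> proper_tubes G \<Longrightarrow> t \<in> proper_tubes G \<Longrightarrow>
      tube_compatible G s t \<longleftrightarrow> tube_compatible G' (\<Phi> s) (\<Phi> t)"
    using assms(5) by (auto simp: nested_complex_isomorphism_def)
  define \<Gamma> where "\<Gamma> = inv_into (proper_tubes G) \<Phi>"
  interpret nested_complex_iso G G' \<Phi> \<Gamma>
  proof
    show "\<Phi> t \<in> proper_tubes G'" if "t \<in> proper_tubes G" for t
      using bij_betwE[OF b] that by blast
    show "\<Gamma> t \<in> proper_tubes G" if "t \<in> proper_tubes G'" for t
      using bij_betwE[OF bij_betw_inv_into[OF b]] that unfolding \<Gamma>_def by blast
    show "\<Gamma> (\<Phi> t) = t" if "t \<in> proper_tubes G" for t
      using bij_betw_inv_into_left[OF b that] unfolding \<Gamma>_def .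
    show "\<Phi> (\<Gamma> t) = t" if "t \<in> proper_tubes G'" for t
      using bij_betw_inv_into_right[OF b that] unfolding \<Gamma>_def .
    show "tube_compatible G s t \<longleftrightarrow> tube_compatible G' (\<Phi> s) (\<Phi> t)"
      if "s \<in> proper_tubes G" "t \<in> proper_tubes G" for s t
      using comp that .
  qed
  obtain t\<^sub>0 where "t\<^sub>0 \<in> proper_tubes G"
    using no_proper_tubes_imp_trivial[OF cG cG' assms(5)] assms(6) by blast
  then have "\<exists>t\<in>proper_tubes G. \<not> straight t"
    using all_straight_imp_trivial assms(6) by blast
  then interpret flipping_iso G G' \<Phi> \<Gamma> by unfold_locales
  obtain l n f where "labelled_flipping_iso G G' \<Phi> \<Gamma> l n f" using ex_labelling by blast
  then interpret labelled_flipping_iso G G' \<Phi> \<Gamma> l n f .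
  define \<theta> where "\<theta> = (\<lambda>(i, j). f i j)"
  define \<theta>' where "\<theta>' = (\<lambda>(i, j). image_coord i j)"
  define S where "S = pverts (spider l n)"
  \<comment> \<open>Both graphs are copies of one spider, and \<psi> matches vertices with equal
    coordinates.\<close>
  define \<psi> where "\<psi> = \<theta>' \<circ> inv_into S \<theta>"
  have \<theta>: "graph_isomorphism \<theta> (spider l n) G" unfolding \<theta>_def by (rule spider_iso)
  have \<theta>': "graph_isomorphism \<theta>' (spider l n) G'" unfolding \<theta>'_def by (rule image_spider_iso)
  have \<psi>: "graph_isomorphism \<psi> G G'"
    unfolding \<psi>_def S_def by (rule graph_isomorphism_comp[OF graph_isomorphism_inv[OF \<theta>] \<theta>'])
  note \<Psi> = graph_isomorphism_nested_complex_isomorphism[OF \<psi> cG cG']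
  then have \<Psi>_bij: "bij_betw (\<lambda>t. \<psi> ` t) (proper_tubes G) (proper_tubes G')"
    and \<Psi>_comp: "\<And>s t. s \<in> proper_tubes G \<Longrightarrow> t \<in> proper_tubes G \<Longrightarrow>
      tube_compatible G s t \<longleftrightarrow> tube_compatible G' (\<psi> ` s) (\<psi> ` t)"
    by (auto simp: nested_complex_isomorphism_def)
  have \<theta>_inj: "inj_on \<theta> S" and \<theta>_img: "\<theta> ` S = pverts G"
    using \<theta> by (auto simp: graph_isomorphism_def bij_betw_def S_def)
  have \<psi>_inj: "inj_on \<psi> (pverts G)"
    using \<psi> by (auto simp: graph_isomorphism_def bij_betw_def)
  have omega: "omega_via l n \<theta> t \<in> proper_tubes G \<and> \<psi> ` omega_via l n \<theta> t = \<Phi> t"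
    if t: "t \<in> proper_tubes G" for t
  proof -
    obtain s where s: "s \<subseteq> S" "spider_omega l n s \<subseteq> S" "t = \<theta> ` s" "\<Phi> t = \<theta>' ` spider_omega l n s"
      using map_eq_omega[OF t] unfolding S_def \<theta>_def \<theta>'_def by blast
    have via: "omega_via l n \<theta> t = \<theta> ` spider_omega l n s"
      unfolding omega_via_def s(3) S_def[symmetric] inv_into_image_cancel[OF \<theta>_inj s(1)] ..
    have image: "\<psi> ` omega_via l n \<theta> t = \<Phi> t"
      unfolding via \<psi>_def image_comp[symmetric] inv_into_image_cancel[OF \<theta>_inj s(2)] s(4) ..
    \<comment> \<open>By injectivity of \<psi>, the tube \<open>r\<close> whose \<psi>-image is
      \<open>\<Phi> t\<close> must be the \<Omega>-image of \<open>t\<close>. So the latter is a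
      proper tube, with no computation on the spider.\<close>
    have "\<Phi> t \<in> (\<lambda>t. \<psi> ` t) ` proper_tubes G"
      using map_proper[OF t] bij_betw_imp_surj_on[OF \<Psi>_bij] by simp
    then obtain r where r: "r \<in> proper_tubes G" "\<psi> ` r = \<Phi> t" by auto
    have "omega_via l n \<theta> t \<subseteq> pverts G" using s(2) \<theta>_img unfolding via by blast
    moreover have "r \<subseteq> pverts G" using G.proper_tube_subset[OF r(1)] by blast
    ultimately have "omega_via l n \<theta> t = r"
      using inj_on_image_eq_iff[OF \<psi>_inj] image r(2) by metis
    with r image show ?thesis by simp
  qed
  have inverse: "(inv_into (proper_tubes G) (\<lambda>t. \<psi> ` t) \<circ> \<Phi>) t = omega_via l n \<theta> t"
    if t: "t \<in> proper_tubes G" for t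
    using bij_betw_inv_into_left[OF \<Psi>_bij, of "omega_via l n \<theta> t"] omega[OF t] by simp
  \<comment> \<open>\<Omega> is an automorphism as a composition of isomorphisms; its explicit
    formula need not be examined.\<close>
  have "bij_betw (omega_via l n \<theta>) (proper_tubes G) (proper_tubes G)"
    using bij_betw_trans[OF b bij_betw_inv_into[OF \<Psi>_bij]] inverse
    by (rule bij_betw_cong[THEN iffD1, rotated])
  moreover have "tube_compatible G s t \<longleftrightarrow> tube_compatible G (omega_via l n \<theta> s) (omega_via l n \<theta> t)"
    if "s \<in> proper_tubes G" "t \<in> proper_tubes G" for s t
    using comp[OF that] \<Psi>_comp omega[OF that(1)] omega[OF that(2)] by simp
  ultimately have omega_iso: "nested_complex_isomorphism G G (omega_via l n \<theta>)"
    by (simp add: nested_complex_isomorphism_def)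
  \<comment> \<open>If \<Omega> came from a graph automorphism \<phi>, then
    \<open>\<psi> \<circ> \<phi>\<close> would induce \<Phi>.\<close>
  have "\<not> trivial_isomorphism G G (omega_via l n \<theta>)"
  proof
    assume "trivial_isomorphism G G (omega_via l n \<theta>)"
    then obtain \<phi> where \<phi>: "graph_isomorphism \<phi> G G"
        and "\<And>t. t \<in> proper_tubes G \<Longrightarrow> omega_via l n \<theta> t = \<phi> ` t"
      by (auto simp: trivial_isomorphism_def)
    then have "\<Phi> t = (\<psi> \<circ> \<phi>) ` t" if "t \<in> proper_tubes G" for t
      using omega[OF that] that by (metis image_comp)
    then have "trivial_isomorphism G G' \<Phi>"
      using graph_isomorphism_comp[OF \<phi> \<psi>] by (auto simp: trivial_isomorphism_def)
    with assms(6) show False by blast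
  qed
  then show ?thesis
    using \<theta> \<theta>' \<psi> \<Psi> omega_iso inverse unfolding is_spider_def by blast
qed

end
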